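(* (a) Let $C$ be a binary self-dual code of length $n$. A necessary and sufficient condition for there to exist a self-dual code $\hat C$ over $\mathbb{Z}_4$ whose reduction mod 2 equals $C$ is that all Hamming weights of codewords of $C$ are divisible by 4. (b) If this condition is satisfied, $\hat C$ can be chosen so that the Euclidean norms of all its codewords are divisible by 8. (c) More generally, let $m$ be even and let $C$ be a self-dual code over $\mathbb{Z}_m$ whose reduction mod 2 is a (binary) self-dual code. Then there exists a self-dual code over $\mathbb{Z}_{2m}$ whose reduction mod $m$ equals $C$ if and only if all Euclidean norms of codewords of $C$ are divisible by $2m$, and in that case such a lifted code can be chosen with all Euclidean norms divisible by $4m$. Consequently, if a code lifts from $\mathbb{Z}_m$ to $\mathbb{Z}_{2m}$ then it lifts (successively) to $\mathbb{Z}_{2^k m}$ for all $k\ge 1$. In particular, if a binary self-dual code lifts to a self-dual code over $\mathbb{Z}_4$, then it lifts to a self-dual code over the 2-adic integers $\mathbb{Z}_2$.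
   Context: For an integer $m\ge2$, a code over $\mathbb{Z}_m=\mathbb{Z}/m\mathbb{Z}$ of length $n$ is a $\mathbb{Z}_m$-submodule of $\mathbb{Z}_m^n$, with inner product $(x,y)=\sum_i x_iy_i \pmod m$; $C^\perp=\{u:(u,v)=0\ \forall v\in C\}$ and $C$ is self-dual if $C=C^\perp$. For $x\in\mathbb{Z}_m$ represented by $x\in\{0,\dots,m-1\}$, $\mathrm{Lee}(x)=\min\{x,m-x\}$, and the Euclidean norm of $u\in\mathbb{Z}_m^n$ is $\mathrm{Norm}(u)=\sum_i \mathrm{Lee}(u_i)^2$ (for binary vectors this is the Hamming weight). Reduction mod $d$ (for $d\mid m$) means applying the ring map $\mathbb{Z}_m\to\mathbb{Z}_d$ coordinatewise to all codewords. A code over the 2-adic integers $\mathbb{Z}_2$ is a $\mathbb{Z}_2$-submodule $C\subseteq\mathbb{Z}_2^n$; it is self-dual if $C=\{u\in\mathbb{Z}_2^n: \sum_i u_iv_i=0\ \forall v\in C\}$, and its reduction mod 2 is its image in $\mathbb{F}_2^n$. *)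

theory Defs
  imports "HOL-Algebra.Module" "HOL-Number_Theory.Residues"
begin

text \<open>
  The free module \<open>R\<^sup>n\<close>. Vectors are extensional functions on \<open>{..<n}\<close>. The ring
  multiplication and unit, which the record type demands but a module does not use, are the
  componentwise ones.
\<close>

definition free_module :: "('a, 'b) ring_scheme \<Rightarrow> nat \<Rightarrow> ('a, nat \<Rightarrow> 'a) module" where
  "free_module R n =
    \<lparr>carrier = {..<n} \<rightarrow>\<^sub>E carrier R,
     monoid.mult = (\<lambda>u v. \<lambda>i\<in>{..<n}. u i \<otimes>\<^bsub>R\<^esub> v i),
     one = (\<lambda>i\<in>{..<n}. \<one>\<^bsub>R\<^esub>),
     zero = (\<lambda>i\<in>{..<n}. \<zero>\<^bsub>R\<^esub>),
     add = (\<lambda>u v. \<lambda>i\<in>{..<n}. u i \<oplus>\<^bsub>R\<^esub> v i),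
     smult = (\<lambda>a u. \<lambda>i\<in>{..<n}. a \<otimes>\<^bsub>R\<^esub> u i)\<rparr>"

definition linear_code :: "('a, 'b) ring_scheme \<Rightarrow> nat \<Rightarrow> (nat \<Rightarrow> 'a) set \<Rightarrow> bool" where
  "linear_code R n C \<longleftrightarrow> submodule C R (free_module R n)"

definition inner_prod :: "('a, 'b) ring_scheme \<Rightarrow> nat \<Rightarrow> (nat \<Rightarrow> 'a) \<Rightarrow> (nat \<Rightarrow> 'a) \<Rightarrow> 'a" where
  "inner_prod R n u v = (\<Oplus>\<^bsub>R\<^esub>i\<in>{..<n}. u i \<otimes>\<^bsub>R\<^esub> v i)"

definition dual_code :: "('a, 'b) ring_scheme \<Rightarrow> nat \<Rightarrow> (nat \<Rightarrow> 'a) set \<Rightarrow> (nat \<Rightarrow> 'a) set" where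
  "dual_code R n C =
    {u \<in> carrier (free_module R n). \<forall>v\<in>C. inner_prod R n u v = \<zero>\<^bsub>R\<^esub>}"

definition self_dual_code :: "('a, 'b) ring_scheme \<Rightarrow> nat \<Rightarrow> (nat \<Rightarrow> 'a) set \<Rightarrow> bool" where
  "self_dual_code R n C \<longleftrightarrow> linear_code R n C \<and> C = dual_code R n C"

definition map_code :: "('a \<Rightarrow> 'b) \<Rightarrow> nat \<Rightarrow> (nat \<Rightarrow> 'a) set \<Rightarrow> (nat \<Rightarrow> 'b) set" where
  "map_code h n C = (\<lambda>u. \<lambda>i\<in>{..<n}. h (u i)) ` C"

text \<open>
  For \<open>d\<close> dividing \<open>m\<close>, the ring map from the integers modulo \<open>m\<close> to those modulo \<open>d\<close> is
  \<open>x \<mapsto> x mod d\<close> on the representatives \<open>{0..m - 1}\<close> used by \<^const>\<open>residue_ring\<close>.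
\<close>

definition reduce_mod :: "int \<Rightarrow> nat \<Rightarrow> (nat \<Rightarrow> int) set \<Rightarrow> (nat \<Rightarrow> int) set" where
  "reduce_mod d n C = map_code (\<lambda>x. x mod d) n C"

definition lee :: "int \<Rightarrow> int \<Rightarrow> int" where
  "lee m x = min x (m - x)"

definition euclidean_norm :: "int \<Rightarrow> nat \<Rightarrow> (nat \<Rightarrow> int) \<Rightarrow> int" where
  "euclidean_norm m n u = (\<Sum>i<n. (lee m (u i))\<^sup>2)"

definition hamming_weight :: "nat \<Rightarrow> (nat \<Rightarrow> int) \<Rightarrow> nat" where
  "hamming_weight n u = card {i \<in> {..<n}. u i \<noteq> 0}"

text \<open>
  The ring of 2-adic integers as the inverse limit of the rings of integers modulo \<open>2 ^ k\<close>:
  an element is the compatible sequence of its residues. The unit is written \<open>1 mod 2 ^ k\<close>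
  because its component at \<open>k = 0\<close> has to be \<open>0\<close>.
\<close>

definition two_adic_ints :: "(nat \<Rightarrow> int) ring" where
  "two_adic_ints =
    \<lparr>carrier = {x. \<forall>k. x k \<in> {0..<2 ^ k} \<and> x (Suc k) mod 2 ^ k = x k},
     monoid.mult = (\<lambda>x y k. (x k * y k) mod 2 ^ k),
     one = (\<lambda>k. 1 mod 2 ^ k),
     zero = (\<lambda>k. 0),
     add = (\<lambda>x y k. (x k + y k) mod 2 ^ k)\<rparr>"

definition two_adic_reduce_mod2 :: "nat \<Rightarrow> (nat \<Rightarrow> nat \<Rightarrow> int) set \<Rightarrow> (nat \<Rightarrow> int) set" where
  "two_adic_reduce_mod2 n C = map_code (\<lambda>x. x 1) n C"

lemma module_free_module:
  assumes "cring R"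
  shows "module R (free_module R n)"
proof -
  interpret R: cring R by (rule assms)
  note [simp] = free_module_def
  show ?thesis
  proof (rule moduleI)
    show "abelian_group (free_module R n)"
    proof (rule abelian_groupI)
      fix u assume u: "u \<in> carrier (free_module R n)"
      show "\<exists>v\<in>carrier (free_module R n). v \<oplus>\<^bsub>free_module R n\<^esub> u = \<zero>\<^bsub>free_module R n\<^esub>"
        using u by (intro bexI[of _ "\<lambda>i\<in>{..<n}. \<ominus>\<^bsub>R\<^esub> u i"])
          (auto simp: fun_eq_iff R.l_neg PiE_iff)
    qed (auto simp: fun_eq_iff PiE_iff extensional_def R.a_ac)
  qed (auto simp: fun_eq_iff PiE_iff extensional_def assms R.l_distr R.r_distr R.m_assoc)
qed

lemma two_adic_compat:
  assumes "x \<in> carrier two_adic_ints"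
  shows "x (Suc k) mod 2 ^ k = x k" "0 \<le> x k" "x k < 2 ^ k" "x k mod 2 ^ k = x k"
  using assms by (auto simp: two_adic_ints_def)

lemma mod_two_power_Suc_mod: "((a::int) mod 2 ^ Suc k) mod 2 ^ k = a mod 2 ^ k"
  by (rule mod_mod_cancel) simp

lemma two_adic_memI:
  assumes "\<And>k. y (Suc k) mod 2 ^ k = y k mod 2 ^ k"
  shows "(\<lambda>k. (y k :: int) mod 2 ^ k) \<in> carrier two_adic_ints"
  unfolding two_adic_ints_def using assms
  by (simp add: mod_two_power_Suc_mod del: power_Suc)

lemma cring_two_adic_ints: "cring two_adic_ints"
proof (rule cringI)
  let ?Z = two_adic_ints
  have ops: "x \<oplus>\<^bsub>?Z\<^esub> y = (\<lambda>k. (x k + y k) mod 2 ^ k)"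
    "x \<otimes>\<^bsub>?Z\<^esub> y = (\<lambda>k. (x k * y k) mod 2 ^ k)"
    "\<zero>\<^bsub>?Z\<^esub> = (\<lambda>k. 0)" "\<one>\<^bsub>?Z\<^esub> = (\<lambda>k. 1 mod 2 ^ k)" for x y
    by (simp_all add: two_adic_ints_def)
  have add_mem: "(\<lambda>k. (x k + y k) mod 2 ^ k) \<in> carrier ?Z"
    and mult_mem: "(\<lambda>k. (x k * y k) mod 2 ^ k) \<in> carrier ?Z"
    if "x \<in> carrier ?Z" "y \<in> carrier ?Z" for x y
    by (rule two_adic_memI,
        metis mod_add_eq mod_mult_eq two_adic_compat(1)[OF that(1)] two_adic_compat(1)[OF that(2)])+
  show "abelian_group ?Z"
  proof (rule abelian_groupI)
    show "\<zero>\<^bsub>?Z\<^esub> \<in> carrier ?Z" by (simp add: two_adic_ints_def)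
    fix x assume x: "x \<in> carrier ?Z"
    have "(\<lambda>k. (- x k) mod 2 ^ k) \<in> carrier ?Z"
      by (rule two_adic_memI) (metis mod_minus_eq two_adic_compat(1)[OF x])
    moreover have "(\<lambda>k. (- x k) mod 2 ^ k) \<oplus>\<^bsub>?Z\<^esub> x = \<zero>\<^bsub>?Z\<^esub>"
      by (simp add: ops mod_add_left_eq)
    ultimately show "\<exists>y\<in>carrier ?Z. y \<oplus>\<^bsub>?Z\<^esub> x = \<zero>\<^bsub>?Z\<^esub>" by blast
    show "\<zero>\<^bsub>?Z\<^esub> \<oplus>\<^bsub>?Z\<^esub> x = x" by (simp add: ops two_adic_compat(4)[OF x])
  qed (simp_all add: ops add_mem mod_add_left_eq mod_add_right_eq add_ac)
  show "Group.comm_monoid ?Z"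
  proof (rule comm_monoidI)
    show "\<one>\<^bsub>?Z\<^esub> \<in> carrier ?Z" unfolding ops by (rule two_adic_memI) simp
    fix x assume x: "x \<in> carrier ?Z"
    show "\<one>\<^bsub>?Z\<^esub> \<otimes>\<^bsub>?Z\<^esub> x = x" unfolding ops
      by (rule ext) (metis mod_mult_left_eq mult_1 two_adic_compat(4)[OF x])
  qed (simp_all add: ops mult_mem mod_mult_left_eq mod_mult_right_eq mult_ac)
qed (simp add: two_adic_ints_def mod_mult_left_eq mod_add_eq distrib_right)

end

theory Submission
  imports Defs Complex_Main
begin

text \<open>
  A self-dual code over the integers modulo \<open>m\<close> is the same thing as its preimage \<open>L\<close> in
  \<open>\<int>\<^sup>n\<close>, a lattice equal to its own dual modulo \<open>m\<close>. If all norms of \<open>L\<close> are divisible by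
  \<open>2 m\<close>, then \<open>q(u) = (u, u) / (2 m)\<close> modulo 2 is a quadratic form on \<open>L / 2 L\<close> with nondegenerate
  polar form \<open>(u, v) / m\<close>. A lift of the code to \<open>2 m\<close> with norms divisible by \<open>4 m\<close> is a totally
  singular complement, between \<open>2 L\<close> and \<open>L\<close>, of the image of \<open>m \<int>\<^sup>n\<close>. Self-duality of \<open>L\<close>
  modulo 2 says that this image is all of \<open>L \<inter> 2 \<int>\<^sup>n\<close>. The complement is built one vector at a time:
  \<open>u\<close> is replaced by \<open>u + m z\<close>, where \<open>z\<close> solves a linear system modulo 2. For \<open>4\<close> dividing \<open>m\<close>
  there is no obstruction. For \<open>m \<equiv> 2\<close> modulo 4 the norm changes by a term governed by the all-ones
  word, and one needs that word to have norm divisible by 8, i.e. that a doubly even self-dual code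
  has length divisible by 8. Since the lifted code again satisfies the norm condition, lifting can
  be iterated, and the limit of the lifts of a binary code is a code over the 2-adic integers.
\<close>

section \<open>The length of a doubly even self-dual code\<close>

lemma card_sym_diff:
  assumes "finite x" "finite c"
  shows "card ((x - c) \<union> (c - x)) + 2 * card (x \<inter> c) = card x + card c"
proof -
  have "card ((x - c) \<union> (c - x)) = card (x - c) + card (c - x)"
    using assms by (intro card_Un_disjoint) auto
  moreover have "card x = card (x - c) + card (x \<inter> c)"
    using assms card_Diff_subset_Int[of x c] card_mono[of x "x \<inter> c"] by simp
  moreover have "card c = card (c - x) + card (x \<inter> c)"
    using assms card_Diff_subset_Int[of c x] card_mono[of c "x \<inter> c"] by (simp add: Int_commute)
  ultimately show ?thesis by simp
qed

text \<open>Since \<open>(1 + \<i>) ^ 8 = 16\<close>, the direction of \<open>(1 + \<i>) ^ n\<close>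
  depends only on \<open>n mod 8\<close>, and only residue 0 points along the positive real
  axis.\<close>

lemma one_plus_ii_power_pos_real:
  assumes "(1 + \<i>) ^ n = of_nat N" "N > 0"
  shows "8 dvd n"
proof -
  define q r where "q = n div 8" and "r = n mod 8"
  have n: "n = 8 * q + r" and "r < 8" by (auto simp: q_def r_def)
  have sq: "(1 + \<i>) ^ 2 = 2 * \<i>" by (simp add: power2_eq_square algebra_simps)
  have pow8: "(1 + \<i>) ^ 8 = 16"
    using power_mult[of "1 + \<i>" 2 4] by (simp add: sq power_mult_distrib)
  have "(1 + \<i>) ^ n = (16 ^ q) *\<^sub>R (1 + \<i>) ^ r"
    by (simp add: n power_add power_mult pow8 scaleR_conv_of_real)
  then have "Re ((1 + \<i>) ^ n) = 16 ^ q * Re ((1 + \<i>) ^ r)" "Im ((1 + \<i>) ^ n) = 16 ^ q * Im ((1 + \<i>) ^ r)"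
    by simp_all
  then have re: "16 ^ q * Re ((1 + \<i>) ^ r) = real N" and im: "Im ((1 + \<i>) ^ r) = 0"
    by (simp_all add: assms(1))
  have "Re ((1 + \<i>) ^ r) > 0"
    using re assms(2) by (metis of_nat_0_less_iff zero_less_mult_pos zero_less_numeral zero_less_power)
  moreover have "r = 0 \<or> r = 1 \<or> r = 2 \<or> r = 3 \<or> r = 4 \<or> r = 5 \<or> r = 6 \<or> r = 7"
    using \<open>r < 8\<close> by auto
  moreover have "(1 + \<i>) ^ 3 = -2 + 2 * \<i>" "(1 + \<i>) ^ 4 = -4" "(1 + \<i>) ^ 5 = -4 - 4 * \<i>"
    "(1 + \<i>) ^ 6 = -8 * \<i>" "(1 + \<i>) ^ 7 = 8 - 8 * \<i>"
    by (simp_all add: eval_nat_numeral algebra_simps)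
  ultimately have "r = 0" using im by (auto simp: sq)
  then show ?thesis by (simp add: n)
qed

text \<open>A MacWilliams-type count, with codewords given by their supports: one Gauss sum is
  evaluated both as \<open>(1 + \<i>) ^ n\<close> and as \<open>card S\<close>, and the latter is
  positive.\<close>

lemma doubly_even_self_dual_length:
  fixes S :: "nat set set"
  assumes sub: "S \<subseteq> Pow {..<n}"
    and doubly_even: "\<And>c. c \<in> S \<Longrightarrow> 4 dvd card c"
    and add: "\<And>c d. c \<in> S \<Longrightarrow> d \<in> S \<Longrightarrow> (c - d) \<union> (d - c) \<in> S"
    and dual: "\<And>x. x \<subseteq> {..<n} \<Longrightarrow> x \<in> S \<longleftrightarrow> (\<forall>c\<in>S. even (card (x \<inter> c)))"
  shows "8 dvd n"
proof -
  have finS: "finite S" using sub finite_subset by blast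
  have fin: "finite x" if "x \<subseteq> {..<n}" for x using that finite_subset by blast
  have "{} \<in> S" using dual[of "{}"] by simp
  then have cardS: "card S > 0" using finS card_gt_0_iff by blast
  \<comment> \<open>Summing \<open>\<i> ^ card x\<close> over all \<open>x\<close>, averaged over the translates by the code, leaves only the
    contribution of the dual code.\<close>
  define \<Gamma> where "\<Gamma> = (\<Sum>x\<in>Pow {..<n}. \<i> ^ card x)"
  have \<Gamma>: "\<Gamma> = (1 + \<i>) ^ n"
    using prod_add[of "{..<n}" "\<lambda>_. \<i>" "\<lambda>_. 1"] by (simp add: \<Gamma>_def add.commute)
  have shift: "(\<Sum>x\<in>Pow {..<n}. \<i> ^ card ((x - c) \<union> (c - x))) = \<Gamma>" if "c \<in> S" for c
    unfolding \<Gamma>_def using that sub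
    by (intro sum.reindex_bij_witness[of _ "\<lambda>x. (x - c) \<union> (c - x)" "\<lambda>x. (x - c) \<union> (c - x)"]) auto
  have unit: "\<i> ^ card c = 1" if "c \<in> S" for c
    using doubly_even[OF that] by (auto elim!: dvdE simp: power_mult)
  \<comment> \<open>Because 4 divides \<open>card c\<close>, translation by \<open>c\<close>
    multiplies the summand only by a sign, the value at \<open>x\<close> of the character belonging
    to \<open>c\<close>.\<close>
  have split: "\<i> ^ card ((x - c) \<union> (c - x)) = \<i> ^ card x * (-1) ^ card (x \<inter> c)"
    if "x \<subseteq> {..<n}" "c \<in> S" for x c
  proof -
    have "\<i> ^ (card ((x - c) \<union> (c - x)) + 2 * card (x \<inter> c)) = \<i> ^ (card x + card c)"
      using card_sym_diff[of x c] fin[of x] fin[of c] that sub by auto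
    then have "\<i> ^ card ((x - c) \<union> (c - x)) * (-1) ^ card (x \<inter> c) = \<i> ^ card x * \<i> ^ card c"
      by (simp add: power_add power_mult)
    moreover note unit[OF that(2)]
    moreover have "(-1 :: complex) ^ card (x \<inter> c) * (-1) ^ card (x \<inter> c) = 1"
      by (simp flip: power_mult_distrib)
    ultimately show ?thesis
      by (metis mult.assoc mult.right_neutral)
  qed
  \<comment> \<open>Orthogonality of characters: for \<open>x\<close> outside \<open>S\<close> some
    \<open>d\<close> in \<open>S\<close> meets \<open>x\<close> in an odd number of points, and
    translation by \<open>d\<close> turns the sum into its own negative.\<close>
  have char: "(\<Sum>c\<in>S. (-1 :: complex) ^ card (x \<inter> c)) = (if x \<in> S then of_nat (card S) else 0)"
    if x: "x \<subseteq> {..<n}" for x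
  proof (cases "x \<in> S")
    case True
    then show ?thesis using dual[OF x] by simp
  next
    case False
    then obtain d where d: "d \<in> S" "odd (card (x \<inter> d))" using dual[OF x] by blast
    have "(-1 :: complex) ^ card (x \<inter> ((c - d) \<union> (d - c))) = - ((-1) ^ card (x \<inter> c))" for c
    proof -
      have "card (x \<inter> ((c - d) \<union> (d - c))) + 2 * card ((x \<inter> c) \<inter> (x \<inter> d)) = card (x \<inter> c) + card (x \<inter> d)"
        using card_sym_diff[of "x \<inter> c" "x \<inter> d"] fin[OF x]
        by (simp add: Int_Un_distrib Diff_Int_distrib)
      then have "even (card (x \<inter> ((c - d) \<union> (d - c)))) \<longleftrightarrow> odd (card (x \<inter> c))"
        using d(2) by presburger
      then show ?thesis by (simp add: minus_one_power_iff)
    qed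
    then have "(\<Sum>c\<in>S. (-1 :: complex) ^ card (x \<inter> c)) = (\<Sum>c\<in>S. - ((-1) ^ card (x \<inter> c)))"
      using d(1) add
      by (intro sum.reindex_bij_witness[of _ "\<lambda>c. (c - d) \<union> (d - c)" "\<lambda>c. (c - d) \<union> (d - c)"]) auto
    then show ?thesis using False by (simp add: sum_negf)
  qed
  have "of_nat (card S) * \<Gamma> = (\<Sum>c\<in>S. \<Sum>x\<in>Pow {..<n}. \<i> ^ card ((x - c) \<union> (c - x)))"
    by (simp add: shift)
  also have "\<dots> = (\<Sum>x\<in>Pow {..<n}. \<i> ^ card x * (\<Sum>c\<in>S. (-1) ^ card (x \<inter> c)))"
    by (subst sum.swap) (simp add: split sum_distrib_left)
  also have "\<dots> = (\<Sum>x\<in>Pow {..<n}. if x \<in> S then of_nat (card S) else 0)"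
    using unit by (intro sum.cong) (auto simp: char)
  also have "\<dots> = of_nat (card S) * of_nat (card S)"
    using sub by (simp add: sum.If_cases Int_absorb1)
  finally have "(1 + \<i>) ^ n = of_nat (card S)" using cardS by (simp add: \<Gamma>)
  then show ?thesis using one_plus_ii_power_pos_real cardS by blast
qed

section \<open>Lattices that are self-dual modulo an integer\<close>

definition dot :: "nat \<Rightarrow> (nat \<Rightarrow> int) \<Rightarrow> (nat \<Rightarrow> int) \<Rightarrow> int" where
  "dot n u v = (\<Sum>i<n. u i * v i)"

lemma dot_commute: "dot n u v = dot n v u"
  by (simp add: dot_def mult.commute)

lemma dot_add_left: "dot n (\<lambda>i. u i + v i) w = dot n u w + dot n v w"
  by (simp add: dot_def distrib_right sum.distrib)

lemma dot_diff_left: "dot n (\<lambda>i. u i - v i) w = dot n u w - dot n v w"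
  by (simp add: dot_def left_diff_distrib sum_subtractf)

lemma dot_scale_left: "dot n (\<lambda>i. c * u i) w = c * dot n u w"
  by (simp add: dot_def sum_distrib_left mult.assoc)

lemma dot_add_right: "dot n w (\<lambda>i. u i + v i) = dot n w u + dot n w v"
  and dot_diff_right: "dot n w (\<lambda>i. u i - v i) = dot n w u - dot n w v"
  and dot_scale_right: "dot n w (\<lambda>i. c * u i) = c * dot n w u"
  using dot_add_left dot_diff_left dot_scale_left by (simp_all add: dot_commute[of n w])

lemmas dot_linear = dot_add_left dot_diff_left dot_scale_left
  dot_add_right dot_diff_right dot_scale_right

lemma dot_cong_mod:
  assumes "\<And>i. i < n \<Longrightarrow> m dvd u i - v i"
  shows "m dvd dot n u w - dot n v w"
  using assms by (auto simp: dot_def left_diff_distrib[symmetric] simp flip: sum_subtractf intro!: dvd_sum dvd_mult2)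

lemma dot_eqI:
  assumes "\<And>i. i < n \<Longrightarrow> u i = v i"
  shows "dot n u w = dot n v w"
  using assms by (simp add: dot_def)

lemma int_card_eq_sum: "int (card {i. i < (n::nat) \<and> P i}) = (\<Sum>i<n. of_bool (P i))"
  by (simp add: Int_def)

lemma even_dot_iff: "even (dot n u v) \<longleftrightarrow> even (card {i. i < n \<and> odd (u i) \<and> odd (v i)})"
proof -
  have "even (dot n u v - int (card {i. i < n \<and> odd (u i) \<and> odd (v i)}))"
    unfolding dot_def int_card_eq_sum sum_subtractf[symmetric]
    by (intro dvd_sum) auto
  then show ?thesis by simp
qed

text \<open>An integer square is 0 or 1 modulo 4 according to parity, so norms modulo 4 are weights
  of the reduction modulo 2.\<close>

lemma dot_self_mod_4: "4 dvd dot n u u - int (card {i. i < n \<and> odd (u i)})"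
  unfolding dot_def int_card_eq_sum sum_subtractf[symmetric]
proof (intro dvd_sum)
  fix i
  show "4 dvd u i * u i - of_bool (odd (u i))"
  proof (cases "even (u i)")
    case True
    then show ?thesis by (auto elim!: evenE)
  next
    case False
    then obtain k where "u i = 2 * k + 1" by (auto elim: oddE)
    then have "u i * u i - of_bool (odd (u i)) = 4 * (k * k + k)" by (simp add: algebra_simps)
    then show ?thesis by (metis dvd_triv_left)
  qed
qed

lemma odd_square_mod_8:
  fixes x :: int
  assumes "odd x"
  shows "8 dvd x * x - 1"
proof -
  obtain k where k: "x = 2 * k + 1" using assms by (auto elim: oddE)
  have "even (k * (k + 1))" by simp
  then obtain j where "k * (k + 1) = 2 * j" by (rule evenE)
  then have "x * x - 1 = 8 * j" by (simp add: k algebra_simps)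
  then show ?thesis by simp
qed

text \<open>
  The functional is given by its graph \<open>R\<close>. This avoids having to show that it is well defined
  before the coordinatewise elimination.
\<close>

lemma mod_2_functional_representation:
  fixes R :: "(nat \<Rightarrow> int) \<Rightarrow> int \<Rightarrow> bool"
  assumes diff: "\<And>a s b t. R a s \<Longrightarrow> R b t \<Longrightarrow> R (\<lambda>i. a i - b i) (s - t)"
    and even: "\<And>a s. R a s \<Longrightarrow> (\<And>i. i < n \<Longrightarrow> even (a i)) \<Longrightarrow> even s"
  shows "\<exists>z. \<forall>a s. R a s \<longrightarrow> even (s - dot n z a)"
proof -
  \<comment> \<open>Gaussian elimination: \<open>k\<close> bounds the coordinates in which an
    argument may be odd. Each stage fixes one more coordinate of \<open>z\<close>, and
    \<open>k = n\<close> removes the restriction.\<close>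
  have "\<exists>z. \<forall>a s. R a s \<longrightarrow> (\<forall>i. k \<le> i \<and> i < n \<longrightarrow> even (a i)) \<longrightarrow> even (s - dot k z a)" for k
  proof (induction k)
    case 0
    then show ?case using even by (auto simp: dot_def)
  next
    case (Suc k)
    then obtain z where z: "\<And>a s. R a s \<Longrightarrow> (\<And>i. k \<le> i \<Longrightarrow> i < n \<Longrightarrow> even (a i)) \<Longrightarrow> even (s - dot k z a)"
      by blast
    have dot_upd: "dot (Suc k) (z(k := c)) a = dot k z a + c * a k" for c a
      by (simp add: dot_def)
    have pattern: "\<And>i. k \<le> i \<Longrightarrow> i < n \<Longrightarrow> even (a i)"
      if "\<forall>i. Suc k \<le> i \<and> i < n \<longrightarrow> even (a i)" "even (a k)" for a :: "nat \<Rightarrow> int"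
      using that by (metis Suc_leI le_neq_implies_less)
    show ?case
    proof (cases "\<exists>b t. R b t \<and> (\<forall>i. Suc k \<le> i \<and> i < n \<longrightarrow> even (b i)) \<and> odd (b k)")
      case True
      then obtain b t where b: "R b t" "\<forall>i. Suc k \<le> i \<and> i < n \<longrightarrow> even (b i)" "odd (b k)" by blast
      \<comment> \<open>The new coordinate of \<open>z\<close> is dictated by the pivot
        \<open>b\<close>, whose entry at \<open>k\<close> is odd. Every other \<open>a\<close> that
        is odd at \<open>k\<close> differs from \<open>b\<close> by a vector of the earlier
        stage.\<close>
      have "even (s - dot (Suc k) (z(k := t - dot k z b)) a)"
        if a: "R a s" "\<forall>i. Suc k \<le> i \<and> i < n \<longrightarrow> even (a i)" for a s
      proof (cases "even (a k)")
        case True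
        then have "even (s - dot k z a)" using z[OF a(1)] pattern a(2) by blast
        then show ?thesis using True by (simp add: dot_upd)
      next
        case False
        then have "even ((s - t) - dot k z (\<lambda>i. a i - b i))"
          using a b z[OF diff[OF a(1) b(1)]] pattern[of "\<lambda>i. a i - b i"] by simp
        then show ?thesis using False by (simp add: dot_upd dot_linear) argo
      qed
      then show ?thesis by blast
    next
      case False
      have "even (s - dot (Suc k) (z(k := 0)) a)"
        if "R a s" "\<forall>i. Suc k \<le> i \<and> i < n \<longrightarrow> even (a i)" for a s
        using z[OF that(1)] pattern[OF that(2)] False that unfolding dot_upd by auto
      then show ?thesis by blast
    qed
  qed
  from this[of n] show ?thesis by (metis not_less)
qed

text \<open>
  Only the coordinates below \<open>n\<close> enter \<^const>\<open>dot\<close>, so a lattice that is self-dual in this sense is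
  unconstrained in the remaining ones.
\<close>

definition self_dual_mod :: "int \<Rightarrow> nat \<Rightarrow> (nat \<Rightarrow> int) set \<Rightarrow> bool" where
  "self_dual_mod m n L \<longleftrightarrow> L = {u. \<forall>v\<in>L. m dvd dot n u v}"

lemma self_dual_modI:
  assumes "\<And>u v. u \<in> L \<Longrightarrow> v \<in> L \<Longrightarrow> m dvd dot n u v"
    and "\<And>u. (\<And>v. v \<in> L \<Longrightarrow> m dvd dot n u v) \<Longrightarrow> u \<in> L"
  shows "self_dual_mod m n L"
  using assms unfolding self_dual_mod_def by blast

context
  fixes m :: int and n :: nat and L :: "(nat \<Rightarrow> int) set"
  assumes sd: "self_dual_mod m n L"
begin

lemma self_dual_mod_dvd: "u \<in> L \<Longrightarrow> v \<in> L \<Longrightarrow> m dvd dot n u v"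
  using sd unfolding self_dual_mod_def by blast

lemma self_dual_mod_memI: "(\<And>v. v \<in> L \<Longrightarrow> m dvd dot n u v) \<Longrightarrow> u \<in> L"
  using sd unfolding self_dual_mod_def by blast

lemma self_dual_mod_add: "u \<in> L \<Longrightarrow> v \<in> L \<Longrightarrow> (\<lambda>i. u i + v i) \<in> L"
  by (rule self_dual_mod_memI) (simp add: dot_linear self_dual_mod_dvd)

lemma self_dual_mod_diff: "u \<in> L \<Longrightarrow> v \<in> L \<Longrightarrow> (\<lambda>i. u i - v i) \<in> L"
  by (rule self_dual_mod_memI) (simp add: dot_linear self_dual_mod_dvd)

lemma self_dual_mod_scale: "u \<in> L \<Longrightarrow> (\<lambda>i. c * u i) \<in> L"
  by (rule self_dual_mod_memI) (simp add: dot_linear self_dual_mod_dvd)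

lemma self_dual_mod_cong:
  assumes "u \<in> L" "\<And>i. i < n \<Longrightarrow> m dvd v i - u i"
  shows "v \<in> L"
proof (rule self_dual_mod_memI)
  fix w assume "w \<in> L"
  then show "m dvd dot n v w"
    using dot_cong_mod[of n m v u w] assms self_dual_mod_dvd[of u w] by (metis diff_add_cancel dvd_add)
qed

lemma self_dual_mod_zero: "(\<lambda>i. 0) \<in> L"
  by (rule self_dual_mod_memI) (simp add: dot_def)

lemma self_dual_mod_multiple: "(\<lambda>i. m * z i) \<in> L"
  by (rule self_dual_mod_memI) (simp add: dot_linear)

end

section \<open>Lattices that satisfy the norm condition\<close>

text \<open>\<open>dual_mod_2\<close> says that the reduction of \<open>L\<close> modulo 2 contains
  its own dual; the opposite inclusion follows from \<open>sd\<close> because \<open>m\<close> is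
  even.\<close>

locale liftable =
  fixes m :: int and n :: nat and L :: "(nat \<Rightarrow> int) set"
  assumes sd: "self_dual_mod m n L"
    and m_pos: "m > 0"
    and m_even: "even m"
    and dual_mod_2: "\<And>z. (\<And>v. v \<in> L \<Longrightarrow> even (dot n z v)) \<Longrightarrow> \<exists>l\<in>L. \<forall>i<n. even (z i - l i)"
    and norm: "\<And>u. u \<in> L \<Longrightarrow> 2 * m dvd dot n u u"
begin

text \<open>Here \<open>2 ^ d * k\<close> is \<open>m / 2 ^ j\<close>. As \<open>2 ^ j * y\<close>
  is orthogonal to \<open>L\<close> modulo \<open>m\<close>, for \<open>d > 0\<close> the vector
  \<open>y\<close> is orthogonal to \<open>L\<close> modulo 2. Hence \<open>y\<close> is a member of
  \<open>L\<close> plus \<open>2 * y'\<close>, and the argument repeats for \<open>y'\<close> with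
  \<open>j + 1\<close>. At \<open>d = 0\<close> only the odd factor \<open>k\<close> remains and a
  Bezout relation suffices.\<close>

lemma power_of_2_torsion:
  assumes m: "m = 2 ^ e * k" and "odd k" and "j + d = e" and "(\<lambda>i. 2 ^ j * y i) \<in> L"
  shows "\<exists>l\<in>L. \<exists>z. \<forall>i<n. y i = l i + 2 ^ d * k * z i"
  using assms(3,4)
proof (induction d arbitrary: j y)
  case 0
  have "coprime (2 ^ e) k" using \<open>odd k\<close> by simp
  then obtain a b where ab: "a * 2 ^ e + b * k = 1"
    by (metis bezout_int coprime_iff_gcd_eq_1)
  have "(\<lambda>i. a * (2 ^ j * y i)) \<in> L" using 0 self_dual_mod_scale[OF sd] by blast
  moreover have "y i = a * (2 ^ j * y i) + 2 ^ 0 * k * (b * y i)" for i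
  proof -
    have "a * (2 ^ j * y i) + 2 ^ 0 * k * (b * y i) = (a * 2 ^ e + b * k) * y i"
      using 0 by (simp add: algebra_simps)
    then show ?thesis by (simp add: ab)
  qed
  ultimately show ?case
    by (intro bexI[of _ "\<lambda>i. a * (2 ^ j * y i)"] exI[of _ "\<lambda>i. b * y i"]) auto
next
  case (Suc d)
  have "even (dot n y v)" if "v \<in> L" for v
  proof -
    have "m = 2 ^ j * (2 * (2 ^ d * k))" using Suc.prems(1) by (auto simp: m power_add)
    then have "2 ^ j * (2 * (2 ^ d * k)) dvd 2 ^ j * dot n y v"
      using self_dual_mod_dvd[OF sd Suc.prems(2) that] by (simp only: dot_linear)
    then have "2 * (2 ^ d * k) dvd dot n y v" by simp
    then show ?thesis by (rule dvd_mult_left)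
  qed
  then obtain l where l: "l \<in> L" "\<And>i. i < n \<Longrightarrow> even (y i - l i)" using dual_mod_2 by blast
  define y' where "y' = (\<lambda>i. (y i - l i) div 2)"
  have y': "y i = l i + 2 * y' i" if "i < n" for i
    using l(2)[OF that] by (simp add: y'_def)
  have "(\<lambda>i. 2 ^ j * y i - 2 ^ j * l i) \<in> L"
    using self_dual_mod_diff[OF sd Suc.prems(2) self_dual_mod_scale[OF sd l(1)]] .
  then have "(\<lambda>i. 2 ^ Suc j * y' i) \<in> L"
    by (rule self_dual_mod_cong[OF sd]) (simp add: y' algebra_simps)
  then obtain l' z where l': "l' \<in> L" "\<And>i. i < n \<Longrightarrow> y' i = l' i + 2 ^ d * k * z i"
    using Suc.IH[of "Suc j" y'] Suc.prems(1) by auto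
  have "y i = (l i + 2 * l' i) + 2 ^ Suc d * k * z i" if "i < n" for i
    using y'[OF that] l'(2)[OF that] by (simp add: algebra_simps)
  moreover have "(\<lambda>i. l i + 2 * l' i) \<in> L"
    using self_dual_mod_add[OF sd l(1) self_dual_mod_scale[OF sd l'(1)]] .
  ultimately show ?case by (intro bexI[of _ "\<lambda>i. l i + 2 * l' i"] exI[of _ z]) auto
qed

text \<open>The case \<open>j = 1\<close> of \<open>power_of_2_torsion\<close>, applied to half of
  \<open>x\<close>. It later turns congruence modulo 2 into congruence modulo
  \<open>m\<close>.\<close>

lemma even_vector_decomposition:
  assumes "x \<in> L" "\<And>i. i < n \<Longrightarrow> even (x i)"
  shows "\<exists>l\<in>L. \<exists>z. \<forall>i<n. x i = 2 * l i + m * z i"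
proof -
  obtain k where k: "m = 2 ^ multiplicity 2 m * k" "odd k"
    using multiplicity_decompose'[of m 2] m_pos by auto
  define e where "e = multiplicity 2 m"
  have "e \<noteq> 0" using k m_even by (auto simp: e_def intro: ccontr)
  then obtain d where d: "e = 1 + d" by (metis add.commute Suc_eq_plus1 not0_implies_Suc)
  have "(\<lambda>i. 2 ^ 1 * (x i div 2)) \<in> L"
    by (rule self_dual_mod_cong[OF sd assms(1)]) (simp add: assms(2))
  then obtain l z where lz: "l \<in> L" "\<And>i. i < n \<Longrightarrow> x i div 2 = l i + 2 ^ d * k * z i"
    using power_of_2_torsion[of e k 1 d "\<lambda>i. x i div 2"] k d e_def by auto
  have "x i = 2 * l i + m * z i" if "i < n" for i
  proof -
    have "x i = 2 * (x i div 2)" using assms(2)[OF that] by simp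
    also have "\<dots> = 2 * l i + m * z i"
      using k(1) d unfolding lz(2)[OF that] by (simp add: e_def algebra_simps)
    finally show ?thesis .
  qed
  then show ?thesis using lz(1) by blast
qed

section \<open>The radical and its totally singular extensions\<close>

text \<open>The radical modulo 2 of the form \<open>(u, v) / m\<close> on \<open>L\<close>; it equals \<open>2 L\<close>.\<close>

definition radical :: "(nat \<Rightarrow> int) set" where
  "radical = {u. \<forall>v\<in>L. 2 * m dvd dot n u v}"

lemma radical_subset: "radical \<subseteq> L"
  by (auto simp: radical_def intro!: self_dual_mod_memI[OF sd] elim: dvd_mult_right)

lemma radical_diff: "u \<in> radical \<Longrightarrow> v \<in> radical \<Longrightarrow> (\<lambda>i. u i - v i) \<in> radical"
  by (simp add: radical_def dot_linear)

lemma radical_add: "u \<in> radical \<Longrightarrow> v \<in> radical \<Longrightarrow> (\<lambda>i. u i + v i) \<in> radical"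
  by (simp add: radical_def dot_linear)

lemma radical_scale: "u \<in> radical \<Longrightarrow> (\<lambda>i. c * u i) \<in> radical"
  by (simp add: radical_def dot_linear)

lemma radical_even_multiple: "u \<in> L \<Longrightarrow> even c \<Longrightarrow> (\<lambda>i. c * u i) \<in> radical"
  by (simp add: radical_def dot_linear self_dual_mod_dvd[OF sd] mult_dvd_mono)

text \<open>Pairing with \<open>m\<close> times a unit vector, a member of \<open>L\<close>,
  isolates one coordinate.\<close>

lemma radical_even:
  assumes "u \<in> radical" "i < n"
  shows "even (u i)"
proof -
  have "(\<lambda>j. m * (if j = i then 1 else 0)) \<in> L" using self_dual_mod_multiple[OF sd] .
  then have "2 * m dvd dot n u (\<lambda>j. m * (if j = i then 1 else 0))" using assms(1) by (auto simp: radical_def)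
  also have "\<dots> = u i * m" using assms(2) unfolding dot_scale_right by (simp add: dot_def if_distrib cong: if_cong)
  finally show ?thesis using m_pos by simp
qed

text \<open>Below \<open>n\<close>, a radical vector is twice a member of \<open>L\<close>, so its
  norm is 4 times a multiple of \<open>2 * m\<close>.\<close>

lemma radical_norm:
  assumes "u \<in> radical"
  shows "4 * m dvd dot n u u"
proof -
  define y where "y = (\<lambda>i. u i div 2)"
  have u: "u i = 2 * y i" if "i < n" for i using radical_even[OF assms that] by (simp add: y_def)
  have du: "dot n u v = 2 * dot n y v" for v
    using dot_eqI[of n u "\<lambda>i. 2 * y i" v] u by (simp add: dot_linear)
  have "y \<in> L" using assms by (intro self_dual_mod_memI[OF sd]) (simp add: radical_def du)
  then have "2 * m dvd dot n y y" by (rule norm)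
  then have "4 * (2 * m) dvd 4 * dot n y y" by (intro mult_dvd_mono) auto
  moreover have "dot n u u = 4 * dot n y y" by (simp add: du dot_commute[of n y u])
  ultimately show ?thesis by (metis dvd_mult_left mult.commute mult.left_commute)
qed

text \<open>
  The vector \<open>p\<close> will represent the functional \<open>z \<mapsto> (m / 2) (z, z)\<close> modulo 2, which measures the
  change of the norm of \<open>u\<close> under a shift by \<open>m z\<close> beyond the term linear in \<open>z\<close>. Keeping \<open>p\<close> in
  \<open>K\<close> makes \<open>u + p\<close> independent of \<open>K\<close> modulo 2 whenever \<open>u\<close> is.
\<close>

definition partial_lift :: "(nat \<Rightarrow> int) \<Rightarrow> (nat \<Rightarrow> int) set \<Rightarrow> bool" where
  "partial_lift p K \<longleftrightarrow> radical \<subseteq> K \<and> K \<subseteq> L \<and> p \<in> K \<and>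
     (\<forall>u\<in>K. \<forall>v\<in>K. (\<lambda>i. u i - v i) \<in> K) \<and>
     (\<forall>u\<in>K. 4 * m dvd dot n u u) \<and>
     (\<forall>u\<in>K. (\<forall>i<n. even (u i)) \<longrightarrow> u \<in> radical)"

lemma partial_lift_diff: "partial_lift p K \<Longrightarrow> u \<in> K \<Longrightarrow> v \<in> K \<Longrightarrow> (\<lambda>i. u i - v i) \<in> K"
  by (simp add: partial_lift_def)

lemma partial_lift_add:
  assumes "partial_lift p K" "u \<in> K" "v \<in> K"
  shows "(\<lambda>i. u i + v i) \<in> K"
proof -
  have "(\<lambda>i. 0) \<in> K" using assms by (auto simp: partial_lift_def radical_def dot_def)
  from partial_lift_diff[OF assms(1,2) partial_lift_diff[OF assms(1) this assms(3)]]
  show ?thesis by simp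
qed

text \<open>Serves both the start, where \<open>K\<close> is \<open>radical\<close> and may lack
  \<open>p\<close>, and each later extension; therefore the properties of \<open>K\<close> are
  listed one by one. An even vector \<open>l + c w\<close> with odd \<open>c\<close> would make
  \<open>w\<close> congruent to \<open>l\<close> modulo 2, which \<open>new\<close> permits only for
  radical \<open>w\<close>.\<close>

lemma partial_lift_adjoin:
  assumes TK: "radical \<subseteq> K" and KL: "K \<subseteq> L"
    and diff: "\<And>u v. u \<in> K \<Longrightarrow> v \<in> K \<Longrightarrow> (\<lambda>i. u i - v i) \<in> K"
    and add: "\<And>u v. u \<in> K \<Longrightarrow> v \<in> K \<Longrightarrow> (\<lambda>i. u i + v i) \<in> K"
    and normK: "\<And>u. u \<in> K \<Longrightarrow> 4 * m dvd dot n u u"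
    and evenK: "\<And>u. u \<in> K \<Longrightarrow> (\<And>i. i < n \<Longrightarrow> even (u i)) \<Longrightarrow> u \<in> radical"
    and wL: "w \<in> L" and norm_w: "4 * m dvd dot n w w"
    and orth: "\<And>l. l \<in> K \<Longrightarrow> 2 * m dvd dot n l w"
    and new: "w \<in> radical \<or> \<not> (\<exists>l\<in>K. \<forall>i<n. even (w i - l i))"
    and K': "K' = {u. \<exists>l\<in>K. \<exists>c. u = (\<lambda>i. l i + c * w i)}"
    and p: "p \<in> K'"
  shows "partial_lift p K'" "K \<subseteq> K'" "w \<in> K'"
proof -
  have zero: "(\<lambda>i. 0) \<in> K" using TK by (auto simp: radical_def dot_def)
  show sub: "K \<subseteq> K'"
  proof
    fix l assume "l \<in> K"
    then show "l \<in> K'" unfolding K' by (auto intro!: bexI[of _ l] exI[of _ 0])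
  qed
  show "w \<in> K'" unfolding K' using zero by (auto intro!: bexI[of _ "\<lambda>i. 0"] exI[of _ 1])
  have "K' \<subseteq> L"
    using KL wL unfolding K' by (auto intro!: self_dual_mod_add[OF sd] self_dual_mod_scale[OF sd])
  moreover have "(\<lambda>i. u i - v i) \<in> K'" if uv: "u \<in> K'" "v \<in> K'" for u v
  proof -
    obtain l c l' c' where "l \<in> K" "u = (\<lambda>i. l i + c * w i)" "l' \<in> K" "v = (\<lambda>i. l' i + c' * w i)"
      using uv unfolding K' by blast
    then show ?thesis
      unfolding K' using diff
      by (auto intro!: bexI[of _ "\<lambda>i. l i - l' i"] exI[of _ "c - c'"] simp: algebra_simps)
  qed
  moreover have "4 * m dvd dot n u u" if u: "u \<in> K'" for u
  proof -
    obtain l c where l: "l \<in> K" "u = (\<lambda>i. l i + c * w i)" using u unfolding K' by blast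
    have "dot n u u = dot n l l + c * (2 * dot n l w) + c * c * dot n w w"
      unfolding l(2) by (simp add: dot_linear dot_commute[of n w l] algebra_simps)
    moreover have "4 * m dvd 2 * dot n l w"
      using mult_dvd_mono[OF dvd_refl[of 2] orth[OF l(1)]] by simp
    ultimately show ?thesis using normK[OF l(1)] norm_w by (simp add: dvd_add dvd_mult)
  qed
  moreover have "u \<in> radical" if u: "u \<in> K'" and ev: "\<And>i. i < n \<Longrightarrow> even (u i)" for u
  proof -
    obtain l c where l: "l \<in> K" "u = (\<lambda>i. l i + c * w i)" using u unfolding K' by blast
    show ?thesis
    proof (cases "w \<in> radical \<or> even c")
      case True
      then have cT: "(\<lambda>i. c * w i) \<in> radical" using radical_scale radical_even_multiple[OF wL] by blast
      have "even (l i)" if "i < n" for i using ev[OF that] radical_even[OF cT that] by (simp add: l(2))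
      then have "l \<in> radical" using evenK l(1) by blast
      then show ?thesis unfolding l(2) using cT by (rule radical_add)
    next
      case False
      then have "\<forall>i<n. even (w i - l i)" using ev by (auto simp: l(2))
      then show ?thesis using new False l(1) by blast
    qed
  qed
  ultimately show "partial_lift p K'" unfolding partial_lift_def using TK sub p by blast
qed

text \<open>The vector adjoined is \<open>u + m z\<close>, congruent to \<open>u\<close> modulo 2.
  Orthogonality to \<open>K\<close> modulo \<open>2 * m\<close> and norm 0 modulo
  \<open>4 * m\<close> form one linear system modulo 2 for \<open>z\<close>, once \<open>p\<close>
  has linearised the quadratic term.\<close>

lemma partial_lift_extend:
  assumes K: "partial_lift p K" and p: "\<And>z. even (m div 2 * dot n z z - dot n p z)" and u: "u \<in> L"
  shows "\<exists>K'. partial_lift p K' \<and> K \<subseteq> K' \<and> (\<exists>v\<in>K'. \<forall>i<n. even (u i - v i))"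
proof (cases "\<exists>v\<in>K. \<forall>i<n. even (u i - v i)")
  case True
  then show ?thesis using K by blast
next
  case False
  then have new: "\<And>v. v \<in> K \<Longrightarrow> \<exists>i<n. odd (u i - v i)" by blast
  obtain t where t: "dot n u u = 2 * m * t" using norm[OF u] by (auto elim: dvdE)
  \<comment> \<open>The graph prescribes \<open>(z, l)\<close> as \<open>(l, u) / m\<close> for
    \<open>l\<close> in \<open>K\<close>, and \<open>(z, u + p)\<close> as
    \<open>t = (u, u) / (2 m)\<close>; signs do not matter modulo 2.\<close>
  define R where "R = (\<lambda>a s. \<exists>l\<in>K. \<exists>c q. a = (\<lambda>i. l i + c * (u i + p i)) \<and> s = q + c * t \<and> dot n l u = m * q)"
  have "\<exists>z. \<forall>a s. R a s \<longrightarrow> even (s - dot n z a)"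
  proof (rule mod_2_functional_representation)
    fix a s b r assume "R a s" "R b r"
    then obtain l c q l' c' q' where
      "l \<in> K" "a = (\<lambda>i. l i + c * (u i + p i))" "s = q + c * t" "dot n l u = m * q"
      "l' \<in> K" "b = (\<lambda>i. l' i + c' * (u i + p i))" "r = q' + c' * t" "dot n l' u = m * q'"
      unfolding R_def by blast
    then show "R (\<lambda>i. a i - b i) (s - r)"
      unfolding R_def using partial_lift_diff[OF K]
      by (intro bexI[of _ "\<lambda>i. l i - l' i"] exI[of _ "c - c'"] exI[of _ "q - q'"])
        (auto simp: algebra_simps dot_linear)
  next
    fix a s assume R: "R a s" and ev: "\<And>i. i < n \<Longrightarrow> even (a i)"
    then obtain l c q where l: "l \<in> K" "a = (\<lambda>i. l i + c * (u i + p i))" "s = q + c * t" "dot n l u = m * q"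
      unfolding R_def by blast
    \<comment> \<open>An odd \<open>c\<close> would make \<open>u\<close> congruent modulo 2 to
      \<open>l - p\<close>, which lies in \<open>K\<close> because \<open>p\<close> does.\<close>
    have "(\<lambda>i. l i - p i) \<in> K" using partial_lift_diff[OF K l(1)] K by (simp add: partial_lift_def)
    from new[OF this] obtain i where "i < n" "odd (u i - (l i - p i))" by blast
    then have c: "even c" using ev[of i] by (auto simp: l(2))
    then have "\<forall>i<n. even (l i)" using ev by (auto simp: l(2))
    then have "l \<in> radical" using K l(1) by (auto simp: partial_lift_def)
    then have "2 * m dvd m * q" using u l(4) by (auto simp: radical_def)
    then have "even q" using m_pos by simp
    then show "even s" using c by (simp add: l(3))
  qed
  then obtain z where z: "\<And>a s. R a s \<Longrightarrow> even (s - dot n z a)" by blast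
  define w where "w = (\<lambda>i. u i + m * z i)"
  have zero: "(\<lambda>i. 0) \<in> K" using K by (auto simp: partial_lift_def radical_def dot_def)
  have "R (\<lambda>i. u i + p i) t"
    unfolding R_def using zero
    by (intro bexI[of _ "\<lambda>i. 0"] exI[of _ 1] exI[of _ 0]) (auto simp: dot_def)
  then have "even (t - (dot n u z + dot n p z))" using z by (fastforce simp: dot_linear dot_commute)
  \<comment> \<open>The quadratic term has the parity of \<open>dot n p z\<close>, so the value
    prescribed on \<open>u + p\<close> is exactly what makes the norm of \<open>w\<close> vanish
    modulo \<open>4 * m\<close>.\<close>
  then have "even (t + dot n u z + m div 2 * dot n z z)" using p[of z] by simp presburger
  then have "2 * m * 2 dvd 2 * m * (t + dot n u z + m div 2 * dot n z z)" by (intro mult_dvd_mono) auto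
  also have "\<dots> = dot n w w"
  proof -
    have "dot n w w = 2 * m * t + 2 * m * dot n u z + m * (m * dot n z z)"
      unfolding w_def dot_linear by (simp add: dot_commute[of n z u] t algebra_simps)
    moreover obtain k where "m = 2 * k" using m_even by (rule evenE)
    ultimately show ?thesis by (simp add: algebra_simps)
  qed
  finally have norm_w: "4 * m dvd dot n w w" by simp
  have orth: "2 * m dvd dot n l w" if "l \<in> K" for l
  proof -
    have "l \<in> L" using K that by (auto simp: partial_lift_def)
    then obtain q where q: "dot n l u = m * q" using self_dual_mod_dvd[OF sd _ u] by (auto elim: dvdE)
    have "R l q" unfolding R_def using that q by (intro bexI[of _ l] exI[of _ 0] exI[of _ q]) auto
    then have "even (q + dot n l z)" using z[of l q] by (simp add: dot_commute)
    then have "m * 2 dvd m * (q + dot n l z)" by (intro mult_dvd_mono) auto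
    then show ?thesis by (simp add: w_def dot_linear q algebra_simps)
  qed
  have uw: "even (u i - w i)" for i using m_even by (simp add: w_def)
  have "\<not> (\<exists>l\<in>K. \<forall>i<n. even (w i - l i))"
  proof -
    have "even (w i - l i) \<longleftrightarrow> even (u i - l i)" for l :: "nat \<Rightarrow> int" and i using uw[of i] by auto
    then show ?thesis using False by simp
  qed
  note new_w = disjI2[OF this]
  define K' where "K' = {u. \<exists>l\<in>K. \<exists>c. u = (\<lambda>i. l i + c * w i)}"
  have pK: "p \<in> K'"
    using K unfolding K'_def by (auto simp: partial_lift_def intro!: bexI[of _ p] exI[of _ 0])
  have wL: "w \<in> L" unfolding w_def by (rule self_dual_mod_add[OF sd u self_dual_mod_multiple[OF sd]])
  have "radical \<subseteq> K" "K \<subseteq> L" "\<And>u. u \<in> K \<Longrightarrow> 4 * m dvd dot n u u"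
    "\<And>u. u \<in> K \<Longrightarrow> (\<And>i. i < n \<Longrightarrow> even (u i)) \<Longrightarrow> u \<in> radical"
    using K by (simp_all add: partial_lift_def)
  note adjoin = partial_lift_adjoin[OF this(1,2) partial_lift_diff[OF K] partial_lift_add[OF K]
      this(3,4) wL norm_w orth new_w K'_def pK]
  show ?thesis using adjoin uw by blast
qed

text \<open>Elimination again: \<open>k\<close> bounds the coordinates in which the members of
  \<open>L\<close> to be reached may be odd. One pivot \<open>b\<close> per coordinate suffices,
  since two members that are odd at \<open>k\<close> differ by a vector already treated.\<close>

lemma partial_lift_complete:
  assumes K: "partial_lift p K" and p: "\<And>z. even (m div 2 * dot n z z - dot n p z)"
  shows "\<exists>K'. partial_lift p K' \<and> (\<forall>u\<in>L. \<exists>v\<in>K'. \<forall>i<n. even (u i - v i))"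
proof -
  have "\<exists>K'. partial_lift p K' \<and>
      (\<forall>u\<in>L. (\<forall>i. k \<le> i \<and> i < n \<longrightarrow> even (u i)) \<longrightarrow> (\<exists>v\<in>K'. \<forall>i<n. even (u i - v i)))" for k
  proof (induction k)
    case 0
    have "(\<lambda>i. 0) \<in> K" using K by (auto simp: partial_lift_def radical_def dot_def)
    then show ?case using K by (intro exI[of _ K]) force
  next
    case (Suc k)
    then obtain K1 where K1: "partial_lift p K1"
      "\<forall>u\<in>L. (\<forall>i. k \<le> i \<and> i < n \<longrightarrow> even (u i)) \<longrightarrow> (\<exists>v\<in>K1. \<forall>i<n. even (u i - v i))"
      by (elim exE conjE)
    then have K1_even: "\<exists>v\<in>K1. \<forall>i<n. even (u i - v i)"
      if "u \<in> L" "\<And>i. k \<le> i \<Longrightarrow> i < n \<Longrightarrow> even (u i)" for u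
      using that by simp
    have pattern: "\<And>i. k \<le> i \<Longrightarrow> i < n \<Longrightarrow> even (a i)"
      if "\<forall>i. Suc k \<le> i \<and> i < n \<longrightarrow> even (a i)" "even (a k)" for a :: "nat \<Rightarrow> int"
      using that by (metis Suc_leI le_neq_implies_less)
    show ?case
    proof (cases "\<exists>b\<in>L. (\<forall>i. Suc k \<le> i \<and> i < n \<longrightarrow> even (b i)) \<and> odd (b k)")
      case True
      then obtain b where b: "b \<in> L" "\<forall>i. Suc k \<le> i \<and> i < n \<longrightarrow> even (b i)" "odd (b k)" by blast
      obtain K2 v where K2: "partial_lift p K2" "K1 \<subseteq> K2" "v \<in> K2" "\<And>i. i < n \<Longrightarrow> even (b i - v i)"
        using partial_lift_extend[OF K1(1) p b(1)] by blast
      have "\<exists>v\<in>K2. \<forall>i<n. even (u i - v i)"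
        if u: "u \<in> L" "\<forall>i. Suc k \<le> i \<and> i < n \<longrightarrow> even (u i)" for u
      proof (cases "even (u k)")
        case True
        then show ?thesis using K1_even[OF u(1)] pattern[OF u(2)] K2(2) by blast
      next
        case False
        have "\<exists>v\<in>K1. \<forall>i<n. even (u i - b i - v i)"
          using u b False K1_even[OF self_dual_mod_diff[OF sd u(1) b(1)]] pattern[of "\<lambda>i. u i - b i"] by simp
        then obtain v' where v': "v' \<in> K2" "\<And>i. i < n \<Longrightarrow> even (u i - b i - v' i)" using K2(2) by blast
        have "even (u i - (v i + v' i))" if "i < n" for i
          using v'(2)[OF that] K2(4)[OF that] by auto
        then show ?thesis by (intro bexI[OF _ partial_lift_add[OF K2(1,3) v'(1)]]) simp
      qed
      then show ?thesis using K2(1) by blast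
    next
      case False
      then have "\<exists>v\<in>K1. \<forall>i<n. even (u i - v i)"
        if "u \<in> L" "\<forall>i. Suc k \<le> i \<and> i < n \<longrightarrow> even (u i)" for u
        using K1_even[OF that(1)] pattern[OF that(2)] that by blast
      then show ?thesis using K1(1) by blast
    qed
  qed
  from this[of n] show ?thesis by (metis not_less)
qed

section \<open>The all-ones word and the obstruction for \<open>m\<close> congruent to 2 modulo
  4\<close>

text \<open>\<open>(v, v)\<close> and the coordinate sum of \<open>v\<close> have the same parity,
  so the all-ones vector is orthogonal to \<open>L\<close> modulo 2 and \<open>dual_mod_2\<close>
  applies to it.\<close>

lemma odd_vector:
  shows "\<exists>h\<in>L. \<forall>i<n. odd (h i)"
proof -
  have "even (dot n (\<lambda>_. 1) v)" if "v \<in> L" for v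
  proof -
    have "even (dot n v v)" using self_dual_mod_dvd[OF sd that that] m_even dvd_trans by blast
    then show ?thesis by (simp add: even_dot_iff)
  qed
  then obtain h where "h \<in> L" "\<forall>i<n. even (1 - h i)" using dual_mod_2[of "\<lambda>_. 1"] by blast
  then show ?thesis by (intro bexI[of _ h]) auto
qed

text \<open>The sets of odd coordinates of members of \<open>L\<close> form a doubly even self-dual
  binary code: 4 divides \<open>2 * m\<close> and hence every norm, and \<open>dual_mod_2\<close>
  supplies the words orthogonal to all others.\<close>

lemma eight_dvd_length:
  assumes "\<not> 4 dvd m"
  shows "8 dvd n"
proof -
  define supp where "supp = (\<lambda>l :: nat \<Rightarrow> int. {i. i < n \<and> odd (l i)})"
  have even_dot: "even (dot n u v) \<longleftrightarrow> even (card (supp u \<inter> supp v))" for u v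
  proof -
    have "{i. i < n \<and> odd (u i) \<and> odd (v i)} = supp u \<inter> supp v" by (auto simp: supp_def)
    then show ?thesis by (simp add: even_dot_iff)
  qed
  show ?thesis
  proof (rule doubly_even_self_dual_length)
    show "supp ` L \<subseteq> Pow {..<n}" by (auto simp: supp_def)
    show "4 dvd card c" if c: "c \<in> supp ` L" for c
    proof -
      obtain l where l: "l \<in> L" "c = supp l" using c by blast
      have "4 dvd 2 * m" using m_even by auto
      then have "4 dvd dot n l l" using norm[OF l(1)] dvd_trans by blast
      then have "4 dvd int (card c)" using dot_self_mod_4[of n l] l(2) dvd_diff_right_iff[of 4 "dot n l l" "int (card c)"]
        by (simp add: supp_def)
      then show ?thesis by presburger
    qed
    show "(c - d) \<union> (d - c) \<in> supp ` L" if cd: "c \<in> supp ` L" "d \<in> supp ` L" for c d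
    proof -
      obtain k l where "k \<in> L" "c = supp k" "l \<in> L" "d = supp l" using cd by blast
      then show ?thesis using self_dual_mod_add[OF sd]
        by (intro image_eqI[of _ _ "\<lambda>i. k i + l i"]) (auto simp: supp_def)
    qed
    show "x \<in> supp ` L \<longleftrightarrow> (\<forall>c\<in>supp ` L. even (card (x \<inter> c)))" if x: "x \<subseteq> {..<n}" for x
    proof
      assume "x \<in> supp ` L"
      then show "\<forall>c\<in>supp ` L. even (card (x \<inter> c))"
        using self_dual_mod_dvd[OF sd] m_even dvd_trans even_dot by blast
    next
      define \<chi> where "\<chi> = (\<lambda>i. of_bool (i \<in> x) :: int)"
      have \<chi>: "supp \<chi> = x" using x by (auto simp: supp_def \<chi>_def)
      assume "\<forall>c\<in>supp ` L. even (card (x \<inter> c))"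
      then have "even (dot n \<chi> v)" if "v \<in> L" for v using that by (simp add: even_dot \<chi>)
      then obtain l where l: "l \<in> L" "\<forall>i<n. even (\<chi> i - l i)" using dual_mod_2 by blast
      then have "supp l = supp \<chi>" by (auto simp: supp_def)
      then show "x \<in> supp ` L" using l(1) \<chi> by blast
    qed
  qed
qed

text \<open>For \<open>4\<close> dividing \<open>m\<close> the functional vanishes and the zero
  vector represents it. Otherwise it is the parity of the coordinate sum, represented by any vector
  with only odd entries.\<close>

lemma norm_representative:
  "\<exists>p\<in>L. 4 * m dvd dot n p p \<and> ((\<forall>i<n. even (p i)) \<longrightarrow> p \<in> radical) \<and>
     (\<forall>z. even (m div 2 * dot n z z - dot n p z))"
proof (cases "4 dvd m")
  case True
  then have "even (m div 2)" by auto
  then show ?thesis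
    using self_dual_mod_zero[OF sd] by (intro bexI[of _ "\<lambda>i. 0"]) (auto simp: dot_def radical_def)
next
  case False
  obtain h where h: "h \<in> L" "\<And>i. i < n \<Longrightarrow> odd (h i)" using odd_vector by blast
  obtain k where k: "m = 2 * k" using m_even by (auto elim: evenE)
  have "odd k" using False k by auto
  \<comment> \<open>Odd squares are 1 modulo 8, so \<open>(h, h)\<close> is congruent to
    \<open>n\<close>, hence to 0, modulo 8. The odd divisor \<open>k\<close> then raises this to
    \<open>8 * k = 4 * m\<close>.\<close>
  have "8 dvd (\<Sum>i<n. h i * h i - 1)" using odd_square_mod_8 h(2) by (intro dvd_sum) auto
  then have "8 dvd dot n h h - int n" by (simp add: sum_subtractf dot_def)
  moreover have "8 dvd int n" using eight_dvd_length[OF False] by presburger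
  ultimately have "8 dvd dot n h h" by (metis diff_add_cancel dvd_add)
  moreover have "k dvd dot n h h" using norm[OF h(1)] k by (metis dvd_mult_right)
  moreover have "coprime (2 ^ 3) k" using \<open>odd k\<close> by (simp only: coprime_power_left_iff) simp
  ultimately have "8 * k dvd dot n h h" using divides_mult[of 8 "dot n h h" k] by simp
  then have "4 * m dvd dot n h h" by (simp add: k)
  moreover have "h \<in> radical" if "\<forall>i<n. even (h i)"
  proof -
    have "n = 0" using that h(2) by blast
    then show ?thesis unfolding radical_def by (simp add: dot_def)
  qed
  moreover have "even (m div 2 * dot n z z - dot n h z)" for z
  proof -
    have "{i. i < n \<and> odd (h i) \<and> odd (z i)} = {i. i < n \<and> odd (z i) \<and> odd (z i)}" using h(2) by auto
    then have "even (dot n h z) \<longleftrightarrow> even (dot n z z)" by (simp add: even_dot_iff)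
    then show ?thesis using \<open>odd k\<close> by (simp add: k)
  qed
  ultimately show ?thesis using h(1) by blast
qed

section \<open>Lifting a lattice from \<open>m\<close> to \<open>2 * m\<close>, once and
  repeatedly\<close>

theorem lift:
  "\<exists>K. self_dual_mod (2 * m) n K \<and> K \<subseteq> L \<and> (\<forall>u\<in>L. \<exists>v\<in>K. \<forall>i<n. m dvd u i - v i) \<and>
     (\<forall>u\<in>K. 4 * m dvd dot n u u)"
proof -
  obtain p where p: "p \<in> L" "4 * m dvd dot n p p" "(\<forall>i<n. even (p i)) \<longrightarrow> p \<in> radical"
    "\<And>z. even (m div 2 * dot n z z - dot n p z)" using norm_representative by blast
  have "p \<in> radical \<or> \<not> (\<exists>l\<in>radical. \<forall>i<n. even (p i - l i))" using p(3) radical_even by fastforce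
  moreover have "2 * m dvd dot n l p" if "l \<in> radical" for l using that p(1) by (simp add: radical_def)
  moreover have "p \<in> {u. \<exists>l\<in>radical. \<exists>c. u = (\<lambda>i. l i + c * p i)}"
    by (rule CollectI, rule bexI[of _ "\<lambda>i. 0"], rule exI[of _ 1]) (auto simp: radical_def dot_def)
  ultimately have "partial_lift p {u. \<exists>l\<in>radical. \<exists>c. u = (\<lambda>i. l i + c * p i)}"
    by (intro partial_lift_adjoin(1)[OF subset_refl radical_subset radical_diff radical_add radical_norm _ p(1,2) _ _ refl])
  from partial_lift_complete[OF this p(4)] obtain K where K: "partial_lift p K"
    and surj: "\<And>u. u \<in> L \<Longrightarrow> \<exists>v\<in>K. \<forall>i<n. even (u i - v i)" by blast
  have KL: "K \<subseteq> L" and TK: "radical \<subseteq> K" and normK: "\<And>u. u \<in> K \<Longrightarrow> 4 * m dvd dot n u u"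
    using K by (auto simp: partial_lift_def)
  \<comment> \<open>The even difference \<open>u - v\<close> is \<open>2 l + m z\<close>, and
    \<open>2 l\<close> is radical, so it may be added to \<open>v\<close> within
    \<open>K\<close>.\<close>
  have surj_m: "\<exists>v\<in>K. \<forall>i<n. m dvd u i - v i" if u: "u \<in> L" for u
  proof -
    obtain v where v: "v \<in> K" "\<And>i. i < n \<Longrightarrow> even (u i - v i)" using surj[OF u] by blast
    then obtain l z where l: "l \<in> L" "\<And>i. i < n \<Longrightarrow> u i - v i = 2 * l i + m * z i"
      using even_vector_decomposition[of "\<lambda>i. u i - v i"] self_dual_mod_diff[OF sd u] KL by blast
    have "(\<lambda>i. 2 * l i) \<in> K" using radical_even_multiple[OF l(1), of 2] TK by auto
    then have "(\<lambda>i. v i + 2 * l i) \<in> K" using partial_lift_add[OF K v(1)] by blast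
    moreover have "m dvd u i - (v i + 2 * l i)" if "i < n" for i
      using l(2)[OF that] by (simp add: algebra_simps)
    ultimately show ?thesis by (intro bexI[of _ "\<lambda>i. v i + 2 * l i"]) auto
  qed
  \<comment> \<open>Polarisation: the norms of \<open>u\<close>, \<open>v\<close> and
    \<open>u + v\<close> leave \<open>2 (u, v)\<close> divisible by \<open>4 * m\<close>.\<close>
  have orth: "2 * m dvd dot n u v" if "u \<in> K" "v \<in> K" for u v
  proof -
    have "4 * m dvd dot n (\<lambda>i. u i + v i) (\<lambda>i. u i + v i) - dot n u u - dot n v v"
      using partial_lift_add[OF K] normK that by (simp add: dvd_diff)
    then have "2 * (2 * m) dvd 2 * dot n u v" by (simp add: dot_linear dot_commute[of n v u])
    then show ?thesis by (subst (asm) dvd_mult_cancel_left) simp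
  qed
  have "self_dual_mod (2 * m) n K"
  proof (rule self_dual_modI)
    show "\<And>u v. u \<in> K \<Longrightarrow> v \<in> K \<Longrightarrow> 2 * m dvd dot n u v" by (rule orth)
    fix x assume x: "\<And>v. v \<in> K \<Longrightarrow> 2 * m dvd dot n x v"
    \<comment> \<open>Testing \<open>x\<close> against \<open>2 * l\<close>, a member of
      \<open>radical\<close> and so of \<open>K\<close>, places \<open>x\<close> in
      \<open>L\<close>.\<close>
    have "m dvd dot n x l" if "l \<in> L" for l
      using x[of "\<lambda>i. 2 * l i"] radical_even_multiple[OF that, of 2] TK by (auto simp: dot_linear)
    then have "x \<in> L" by (rule self_dual_mod_memI[OF sd])
    then obtain v where v: "v \<in> K" "\<And>i. i < n \<Longrightarrow> m dvd x i - v i" using surj_m by blast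
    define z where "z = (\<lambda>i. (x i - v i) div m)"
    have z: "x i = v i + m * z i" if "i < n" for i using v(2)[OF that] by (simp add: z_def)
    \<comment> \<open>\<open>m z = x - v\<close> is orthogonal to \<open>K\<close> modulo
      \<open>2 * m\<close>, and \<open>K\<close> represents all of \<open>L\<close> modulo 2. So
      \<open>z\<close> is congruent modulo 2 to a member of \<open>L\<close>, which makes
      \<open>x - v\<close> radical.\<close>
    have "even (dot n z l)" if "l \<in> L" for l
    proof -
      obtain k where k: "k \<in> K" "\<And>i. i < n \<Longrightarrow> even (l i - k i)" using surj[OF \<open>l \<in> L\<close>] by blast
      have "dot n x k = dot n v k + m * dot n z k"
        using dot_eqI[of n x "\<lambda>i. v i + m * z i" k] z by (simp add: dot_linear)
      moreover have "2 * m dvd dot n x k" using x k(1) .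
      moreover have "2 * m dvd dot n v k" using orth v(1) k(1) .
      ultimately have "2 * m dvd m * dot n z k" by (simp add: dvd_add_right_iff)
      then have "even (dot n z k)" using m_pos by simp
      then show ?thesis using dot_cong_mod[of n 2 l k z] k(2) by (simp add: dot_commute)
    qed
    then obtain l where l: "l \<in> L" "\<And>i. i < n \<Longrightarrow> even (z i - l i)" using dual_mod_2 by blast
    have "(\<lambda>i. x i - v i) \<in> radical"
    proof -
      have "2 * m dvd dot n (\<lambda>i. x i - v i) k" if "k \<in> L" for k
      proof -
        have "even (dot n l k)" using self_dual_mod_dvd[OF sd l(1) that] m_even dvd_trans by blast
        then have "even (dot n z k)" using dot_cong_mod[of n 2 z l k] l(2) by simp
        then have "m * 2 dvd m * dot n z k" by (intro mult_dvd_mono) auto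
        moreover have "dot n (\<lambda>i. x i - v i) k = m * dot n z k"
          using dot_eqI[of n "\<lambda>i. x i - v i" "\<lambda>i. m * z i" k] z by (simp add: dot_linear)
        ultimately show ?thesis by (simp add: mult.commute)
      qed
      then show ?thesis by (simp add: radical_def)
    qed
    then have "(\<lambda>i. v i + (x i - v i)) \<in> K" using partial_lift_add[OF K v(1)] TK by blast
    then show "x \<in> K" by simp
  qed
  then show ?thesis using KL surj_m normK by blast
qed

text \<open>The hypotheses recur at \<open>2 * m\<close>: the norms are divisible by
  \<open>4 * m\<close>, and \<open>K\<close> has the same reduction modulo 2 as \<open>L\<close>,
  which transfers \<open>dual_mod_2\<close>.\<close>

lemma lift_liftable:
  "\<exists>K. liftable (2 * m) n K \<and> K \<subseteq> L \<and> (\<forall>u\<in>L. \<exists>v\<in>K. \<forall>i<n. m dvd u i - v i)"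
proof -
  obtain K where K: "self_dual_mod (2 * m) n K" "K \<subseteq> L" "\<And>u. u \<in> K \<Longrightarrow> 4 * m dvd dot n u u"
    and surj: "\<And>u. u \<in> L \<Longrightarrow> \<exists>v\<in>K. \<forall>i<n. m dvd u i - v i"
    using lift by blast
  have surj_2: "\<exists>v\<in>K. \<forall>i<n. even (u i - v i)" if "u \<in> L" for u
    using surj[OF that] m_even dvd_trans by blast
  have "liftable (2 * m) n K"
  proof
    show "self_dual_mod (2 * m) n K" by (rule K)
    show "2 * (2 * m) dvd dot n u u" if "u \<in> K" for u using K(3)[OF that] by simp
    fix z assume z: "\<And>v. v \<in> K \<Longrightarrow> even (dot n z v)"
    have "even (dot n z l)" if l: "l \<in> L" for l
    proof -
      obtain k where k: "k \<in> K" "\<And>i. i < n \<Longrightarrow> even (l i - k i)" using surj_2[OF l] by blast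
      then show ?thesis using dot_cong_mod[of n 2 l k z] z[OF k(1)] by (simp add: dot_commute)
    qed
    then obtain l where l: "l \<in> L" "\<And>i. i < n \<Longrightarrow> even (z i - l i)" using dual_mod_2 by blast
    obtain k where k: "k \<in> K" "\<And>i. i < n \<Longrightarrow> even (l i - k i)" using surj_2[OF l(1)] by blast
    have "\<forall>i<n. even (z i - k i)" using l(2) k(2) by fastforce
    then show "\<exists>l\<in>K. \<forall>i<n. even (z i - l i)" using k(1) by blast
  qed (use m_pos in auto)
  then show ?thesis using K(2) surj by blast
qed

lemma lift_chain:
  "\<exists>K. K 0 = L \<and> (\<forall>k. liftable (2 ^ k * m) n (K k) \<and> K (Suc k) \<subseteq> K k \<and>
     (\<forall>u\<in>K k. \<exists>v\<in>K (Suc k). \<forall>i<n. 2 ^ k * m dvd u i - v i))"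
proof -
  \<comment> \<open>The clause for \<open>k = 0\<close> pins the first lattice to \<open>L\<close>;
    dependent choice by itself yields only some initial lattice.\<close>
  have "\<exists>K. \<forall>k. (liftable (2 ^ k * m) n (K k) \<and> (k = 0 \<longrightarrow> K k = L)) \<and>
      (K (Suc k) \<subseteq> K k \<and> (\<forall>u\<in>K k. \<exists>v\<in>K (Suc k). \<forall>i<n. 2 ^ k * m dvd u i - v i))"
  proof (rule dependent_nat_choice)
    show "\<exists>K. liftable (2 ^ 0 * m) n K \<and> (0 = (0 :: nat) \<longrightarrow> K = L)"
      using liftable_axioms by auto
    fix K k
    assume "liftable (2 ^ k * m) n K \<and> (k = 0 \<longrightarrow> K = L)"
    then interpret K: liftable "2 ^ k * m" n K by blast
    show "\<exists>K'. (liftable (2 ^ Suc k * m) n K' \<and> (Suc k = 0 \<longrightarrow> K' = L)) \<and>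
        (K' \<subseteq> K \<and> (\<forall>u\<in>K. \<exists>v\<in>K'. \<forall>i<n. 2 ^ k * m dvd u i - v i))"
      using K.lift_liftable by (simp add: mult.assoc)
  qed
  then obtain K where K: "\<forall>k. (liftable (2 ^ k * m) n (K k) \<and> (k = 0 \<longrightarrow> K k = L)) \<and>
      (K (Suc k) \<subseteq> K k \<and> (\<forall>u\<in>K k. \<exists>v\<in>K (Suc k). \<forall>i<n. 2 ^ k * m dvd u i - v i))"
    by (elim exE)
  show ?thesis using K by (intro exI[of _ K]) simp
qed

end

section \<open>Codes and lattices\<close>

lemma cring_residue_ring: "m > 1 \<Longrightarrow> cring (residue_ring m)"
  using residues.cring[OF residues.intro] .

lemma finsum_residue_ring:
  fixes j :: nat
  assumes "m > 1" "\<And>i. i < j \<Longrightarrow> f i \<in> carrier (residue_ring m)"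
  shows "(\<Oplus>\<^bsub>residue_ring m\<^esub>i\<in>{..<j}. f i) = (\<Sum>i<j. f i) mod m"
proof -
  interpret R: cring "residue_ring m" by (rule cring_residue_ring[OF assms(1)])
  have add: "a \<oplus>\<^bsub>residue_ring m\<^esub> b = (a + b) mod m" for a b by (simp add: residue_ring_def)
  have zero: "\<zero>\<^bsub>residue_ring m\<^esub> = 0" by (simp add: residue_ring_def)
  show ?thesis
    using assms(2)
  proof (induction j)
    case 0
    then show ?case by (simp add: zero)
  next
    case (Suc j)
    have "(\<Oplus>\<^bsub>residue_ring m\<^esub>i\<in>{..<Suc j}. f i) = f j \<oplus>\<^bsub>residue_ring m\<^esub> (\<Oplus>\<^bsub>residue_ring m\<^esub>i\<in>{..<j}. f i)"
      unfolding lessThan_Suc using Suc.prems by (intro R.finsum_insert) auto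
    then show ?case using Suc by (simp add: add mod_add_right_eq add.commute)
  qed
qed

lemma finsum_two_adic_ints:
  fixes j :: nat
  assumes "\<And>i. i < j \<Longrightarrow> f i \<in> carrier two_adic_ints"
  shows "(\<Oplus>\<^bsub>two_adic_ints\<^esub>i\<in>{..<j}. f i) k = (\<Sum>i<j. f i k) mod 2 ^ k"
  using assms
proof (induction j)
  interpret R: cring two_adic_ints by (rule cring_two_adic_ints)
  case 0
  have "\<zero>\<^bsub>two_adic_ints\<^esub> = (\<lambda>k. 0)" by (simp add: two_adic_ints_def)
  then show ?case by simp
next
  interpret R: cring two_adic_ints by (rule cring_two_adic_ints)
  case (Suc j)
  have add: "(a \<oplus>\<^bsub>two_adic_ints\<^esub> b) k = (a k + b k) mod 2 ^ k" for a b by (simp add: two_adic_ints_def)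
  have "(\<Oplus>\<^bsub>two_adic_ints\<^esub>i\<in>{..<Suc j}. f i) = f j \<oplus>\<^bsub>two_adic_ints\<^esub> (\<Oplus>\<^bsub>two_adic_ints\<^esub>i\<in>{..<j}. f i)"
    unfolding lessThan_Suc using Suc.prems by (intro R.finsum_insert) auto
  then show ?case using Suc by (simp add: add mod_add_right_eq add.commute)
qed

lemma inner_prod_residue_ring:
  assumes "m > 1"
  shows "inner_prod (residue_ring m) n u v = dot n u v mod m"
proof -
  have "u i \<otimes>\<^bsub>residue_ring m\<^esub> v i = (u i * v i) mod m" for i by (simp add: residue_ring_def)
  moreover have "a mod m \<in> carrier (residue_ring m)" for a
    using assms by (simp add: residue_ring_def)
  ultimately have "inner_prod (residue_ring m) n u v = (\<Sum>i<n. (u i * v i) mod m) mod m"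
    unfolding inner_prod_def using assms by (simp add: finsum_residue_ring)
  then show ?thesis by (simp add: mod_sum_eq dot_def)
qed

lemma inner_prod_two_adic_ints:
  assumes "\<And>i. i < n \<Longrightarrow> u i \<in> carrier two_adic_ints" "\<And>i. i < n \<Longrightarrow> v i \<in> carrier two_adic_ints"
  shows "inner_prod two_adic_ints n u v k = dot n (\<lambda>i. u i k) (\<lambda>i. v i k) mod 2 ^ k"
proof -
  interpret R: cring two_adic_ints by (rule cring_two_adic_ints)
  have "(u i \<otimes>\<^bsub>two_adic_ints\<^esub> v i) k = (u i k * v i k) mod 2 ^ k" for i by (simp add: two_adic_ints_def)
  then have "inner_prod two_adic_ints n u v k = (\<Sum>i<n. (u i k * v i k) mod 2 ^ k) mod 2 ^ k"
    unfolding inner_prod_def using assms by (simp add: finsum_two_adic_ints)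
  then show ?thesis by (simp add: mod_sum_eq dot_def)
qed

text \<open>Linearity of the inner product in its first argument. Self-duality thereby reduces to
  the equation \<open>C = dual_code R n C\<close>, over residue rings and over the 2-adic integers
  alike.\<close>

lemma linear_code_dual_code:
  assumes "cring R" and C: "C \<subseteq> carrier (free_module R n)"
  shows "linear_code R n (dual_code R n C)"
proof -
  interpret R: cring R by fact
  interpret M: module R "free_module R n" by (rule module_free_module[OF assms(1)])
  have car: "u \<in> carrier (free_module R n) \<Longrightarrow> i < n \<Longrightarrow> u i \<in> carrier R" for u i
    by (auto simp: free_module_def)
  have add: "inner_prod R n (u \<oplus>\<^bsub>free_module R n\<^esub> v) w = inner_prod R n u w \<oplus>\<^bsub>R\<^esub> inner_prod R n v w"
    if "u \<in> carrier (free_module R n)" "v \<in> carrier (free_module R n)" "w \<in> carrier (free_module R n)" for u v w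
  proof -
    have "inner_prod R n (u \<oplus>\<^bsub>free_module R n\<^esub> v) w = (\<Oplus>\<^bsub>R\<^esub>i\<in>{..<n}. u i \<otimes>\<^bsub>R\<^esub> w i \<oplus>\<^bsub>R\<^esub> v i \<otimes>\<^bsub>R\<^esub> w i)"
      unfolding inner_prod_def
      by (rule R.finsum_cong') (use that in \<open>auto simp: car free_module_def R.l_distr PiE_iff\<close>)
    also have "\<dots> = inner_prod R n u w \<oplus>\<^bsub>R\<^esub> inner_prod R n v w"
      unfolding inner_prod_def using that by (intro R.finsum_addf) (auto simp: car)
    finally show ?thesis .
  qed
  have smult: "inner_prod R n (a \<odot>\<^bsub>free_module R n\<^esub> u) w = a \<otimes>\<^bsub>R\<^esub> inner_prod R n u w"
    if "a \<in> carrier R" "u \<in> carrier (free_module R n)" "w \<in> carrier (free_module R n)" for a u w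
  proof -
    have "inner_prod R n (a \<odot>\<^bsub>free_module R n\<^esub> u) w = (\<Oplus>\<^bsub>R\<^esub>i\<in>{..<n}. a \<otimes>\<^bsub>R\<^esub> (u i \<otimes>\<^bsub>R\<^esub> w i))"
      unfolding inner_prod_def
      by (rule R.finsum_cong') (use that in \<open>auto simp: car free_module_def R.m_assoc PiE_iff\<close>)
    also have "\<dots> = a \<otimes>\<^bsub>R\<^esub> inner_prod R n u w"
      unfolding inner_prod_def using that by (subst R.finsum_rdistr) (auto simp: car)
    finally show ?thesis .
  qed
  have smult_closed: "a \<odot>\<^bsub>free_module R n\<^esub> u \<in> dual_code R n C"
    if "a \<in> carrier R" "u \<in> dual_code R n C" for a u
    using that C by (auto simp: dual_code_def smult)
  show ?thesis
    unfolding linear_code_def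
  proof (rule M.submoduleI)
    show "dual_code R n C \<subseteq> carrier (free_module R n)" by (auto simp: dual_code_def)
    have "inner_prod R n \<zero>\<^bsub>free_module R n\<^esub> w = \<zero>\<^bsub>R\<^esub>" if "w \<in> carrier (free_module R n)" for w
      using smult[OF R.zero_closed M.zero_closed that]
      by (simp add: inner_prod_def R.finsum_closed car that)
    then show "\<zero>\<^bsub>free_module R n\<^esub> \<in> dual_code R n C" using C by (auto simp: dual_code_def)
    show "\<ominus>\<^bsub>free_module R n\<^esub> u \<in> dual_code R n C" if u: "u \<in> dual_code R n C" for u
    proof -
      have "u \<in> carrier (free_module R n)" using u by (simp add: dual_code_def)
      then show ?thesis using smult_closed[of "\<ominus>\<^bsub>R\<^esub> \<one>\<^bsub>R\<^esub>" u] u by (simp add: M.smult_l_minus)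
    qed
    show "u \<oplus>\<^bsub>free_module R n\<^esub> v \<in> dual_code R n C" if "u \<in> dual_code R n C" "v \<in> dual_code R n C" for u v
      using that C by (auto simp: dual_code_def add)
  qed (rule smult_closed)
qed

lemma self_dual_codeI:
  assumes "cring R" "C = dual_code R n C"
  shows "self_dual_code R n C"
proof -
  have "C \<subseteq> carrier (free_module R n)" using assms(2) by (auto simp: dual_code_def)
  then show ?thesis using linear_code_dual_code[OF assms(1)] assms(2) by (metis self_dual_code_def)
qed

section \<open>Self-dual codes over residue rings as reductions of lattices\<close>

lemma carrier_free_module_residue_ring:
  "carrier (free_module (residue_ring m) n) = {..<n} \<rightarrow>\<^sub>E {0..m - 1}"
  by (simp add: free_module_def residue_ring_def)

definition reduce_vec :: "int \<Rightarrow> nat \<Rightarrow> (nat \<Rightarrow> int) \<Rightarrow> nat \<Rightarrow> int" where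
  "reduce_vec m n u = (\<lambda>i\<in>{..<n}. u i mod m)"

lemma reduce_mod_eq_image: "reduce_mod m n C = reduce_vec m n ` C"
  by (simp add: reduce_mod_def map_code_def reduce_vec_def)

lemma reduce_vec_eq_iff: "reduce_vec m n u = reduce_vec m n v \<longleftrightarrow> (\<forall>i<n. m dvd u i - v i)"
  by (auto simp: reduce_vec_def fun_eq_iff restrict_def mod_eq_dvd_iff)

lemma reduce_vec_id: "u \<in> {..<n} \<rightarrow>\<^sub>E {0..m - 1} \<Longrightarrow> reduce_vec m n u = u"
  by (auto simp: reduce_vec_def fun_eq_iff PiE_iff extensional_def)

lemma reduce_vec_carrier: "m > 0 \<Longrightarrow> reduce_vec m n u \<in> {..<n} \<rightarrow>\<^sub>E {0..m - 1}"
  by (auto simp: reduce_vec_def)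

lemma reduce_vec_reduce_vec: "d dvd m \<Longrightarrow> reduce_vec d n (reduce_vec m n u) = reduce_vec d n u"
  by (auto simp: reduce_vec_def fun_eq_iff mod_mod_cancel)

lemma reduce_mod_reduce_mod: "d dvd m \<Longrightarrow> reduce_mod d n (reduce_mod m n C) = reduce_mod d n C"
  by (simp add: reduce_mod_eq_image image_image reduce_vec_reduce_vec)

lemma reduce_mod_subsetI:
  assumes "\<And>u. u \<in> C \<Longrightarrow> \<exists>v\<in>D. \<forall>i<n. m dvd u i - v i"
  shows "reduce_mod m n C \<subseteq> reduce_mod m n D"
  using assms unfolding reduce_mod_eq_image by (metis image_subsetI imageI reduce_vec_eq_iff)

lemma dvd_dot_reduce_vec_left: "m dvd dot n (reduce_vec m n u) v \<longleftrightarrow> m dvd dot n u v"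
proof -
  have "m dvd dot n (reduce_vec m n u) v - dot n u v"
    by (rule dot_cong_mod) (simp add: reduce_vec_def flip: mod_eq_dvd_iff)
  then show ?thesis by (metis dvd_add_right_iff diff_add_cancel)
qed

lemma dvd_dot_reduce_vec:
  "m dvd dot n (reduce_vec m n u) (reduce_vec m n v) \<longleftrightarrow> m dvd dot n u v"
  by (metis dvd_dot_reduce_vec_left dot_commute)

lemma dual_code_residue_ring:
  assumes "m > 1"
  shows "dual_code (residue_ring m) n C = {u \<in> {..<n} \<rightarrow>\<^sub>E {0..m - 1}. \<forall>v\<in>C. m dvd dot n u v}"
  using assms
  by (auto simp: dual_code_def carrier_free_module_residue_ring inner_prod_residue_ring)
    (auto simp: residue_ring_def dvd_eq_mod_eq_0)

lemma self_dual_code_residue_ringD: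
  assumes m: "m > 1" and C: "self_dual_code (residue_ring m) n C"
  obtains L where "self_dual_mod m n L" "C = reduce_mod m n L"
proof
  \<comment> \<open>The full preimage of \<open>C\<close>; entries from \<open>n\<close> on are
    arbitrary.\<close>
  define L where "L = {u. reduce_vec m n u \<in> C}"
  have dual: "C = {u \<in> {..<n} \<rightarrow>\<^sub>E {0..m - 1}. \<forall>v\<in>C. m dvd dot n u v}"
    using C dual_code_residue_ring[OF m, of n C] by (simp add: self_dual_code_def)
  have CL: "c \<in> L" "reduce_vec m n c = c" if "c \<in> C" for c
  proof -
    have "c \<in> {..<n} \<rightarrow>\<^sub>E {0..m - 1}" using that dual by blast
    then show "reduce_vec m n c = c" by (rule reduce_vec_id)
    then show "c \<in> L" using that by (simp add: L_def)
  qed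
  have "C \<subseteq> reduce_vec m n ` L" by (metis CL imageI subsetI)
  then show "C = reduce_mod m n L" unfolding reduce_mod_eq_image by (auto simp: L_def)
  show "self_dual_mod m n L"
  proof (rule self_dual_modI)
    fix u v assume "u \<in> L" "v \<in> L"
    then have "m dvd dot n (reduce_vec m n u) (reduce_vec m n v)" using dual by (auto simp: L_def)
    then show "m dvd dot n u v" by (simp add: dvd_dot_reduce_vec)
  next
    fix u assume "\<And>v. v \<in> L \<Longrightarrow> m dvd dot n u v"
    then have "\<forall>v\<in>C. m dvd dot n (reduce_vec m n u) v" using CL by (simp add: dvd_dot_reduce_vec_left)
    moreover have "reduce_vec m n u \<in> {..<n} \<rightarrow>\<^sub>E {0..m - 1}" using m by (simp add: reduce_vec_carrier)
    ultimately have "reduce_vec m n u \<in> C" by (subst dual) blast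
    then show "u \<in> L" by (simp add: L_def)
  qed
qed

lemma self_dual_code_reduce_mod:
  assumes m: "m > 1" and L: "self_dual_mod m n L"
  shows "self_dual_code (residue_ring m) n (reduce_mod m n L)"
proof (rule self_dual_codeI)
  show "cring (residue_ring m)" by (rule cring_residue_ring[OF m])
  have "u \<in> reduce_vec m n ` L \<longleftrightarrow> u \<in> {..<n} \<rightarrow>\<^sub>E {0..m - 1} \<and> (\<forall>v\<in>reduce_vec m n ` L. m dvd dot n u v)" for u
  proof
    assume "u \<in> reduce_vec m n ` L"
    then show "u \<in> {..<n} \<rightarrow>\<^sub>E {0..m - 1} \<and> (\<forall>v\<in>reduce_vec m n ` L. m dvd dot n u v)"
      using m reduce_vec_carrier[of m n] self_dual_mod_dvd[OF L] by (auto simp: dvd_dot_reduce_vec)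
  next
    assume u: "u \<in> {..<n} \<rightarrow>\<^sub>E {0..m - 1} \<and> (\<forall>v\<in>reduce_vec m n ` L. m dvd dot n u v)"
    then have "m dvd dot n u v" if "v \<in> L" for v
      using that dvd_dot_reduce_vec_left[of m n v u] by (simp add: dot_commute)
    then have "u \<in> L" by (rule self_dual_mod_memI[OF L])
    then show "u \<in> reduce_vec m n ` L" using u by (metis imageI reduce_vec_id)
  qed
  then show "reduce_mod m n L = dual_code (residue_ring m) n (reduce_mod m n L)"
    unfolding dual_code_residue_ring[OF m] reduce_mod_eq_image by blast
qed

section \<open>Euclidean norms of codes and integral norms of lattices\<close>

text \<open>The Lee value is congruent to \<open>x\<close> or \<open>- x\<close> modulo
  \<open>m\<close>, and adding \<open>m a\<close> to \<open>x\<close> changes the square by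
  \<open>2 m a x + m^2 a^2\<close>, where \<open>2 * m\<close> divides \<open>m^2\<close> for even
  \<open>m\<close>.\<close>

lemma lee_square_cong:
  assumes "even m"
  shows "2 * m dvd (lee m (x mod m))\<^sup>2 - x * x"
proof -
  obtain k where k: "m = 2 * k" using assms by (rule evenE)
  define q r where "q = x div m" and "r = x mod m"
  have x: "x = q * m + r" by (simp add: q_def r_def)
  have "r\<^sup>2 - x * x = 2 * m * (- (q * q * k) - q * r)"
    unfolding x k power2_eq_square by (simp add: algebra_simps)
  moreover have "(m - r)\<^sup>2 - x * x = 2 * m * (k - r - q * q * k - q * r)"
    unfolding x k power2_eq_square by (simp add: algebra_simps)
  ultimately show ?thesis unfolding lee_def r_def[symmetric] min_def by (metis dvd_triv_left)
qed

lemma dvd_euclidean_norm_reduce_vec: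
  assumes "even m"
  shows "2 * m dvd euclidean_norm m n (reduce_vec m n u) \<longleftrightarrow> 2 * m dvd dot n u u"
proof -
  have "2 * m dvd euclidean_norm m n (reduce_vec m n u) - dot n u u"
    unfolding euclidean_norm_def dot_def sum_subtractf[symmetric]
    using lee_square_cong[OF assms] by (intro dvd_sum) (simp add: reduce_vec_def)
  then show ?thesis by (metis dvd_add_right_iff diff_add_cancel)
qed

lemma dvd_norm_of_dvd_diff:
  assumes "even m" "\<And>i. i < n \<Longrightarrow> m dvd u i - v i" "2 * m dvd dot n v v"
  shows "2 * m dvd dot n u u"
proof -
  define w where "w = (\<lambda>i. (u i - v i) div m)"
  obtain k where k: "m = 2 * k" using assms(1) by (rule evenE)
  have "u i = v i + m * w i" if "i < n" for i using assms(2)[OF that] by (simp add: w_def)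
  then have "dot n u u = dot n (\<lambda>i. v i + m * w i) (\<lambda>i. v i + m * w i)" by (simp add: dot_def)
  also have "\<dots> = dot n v v + 2 * m * (dot n v w + k * dot n w w)"
    unfolding dot_linear by (simp add: k dot_commute[of n w v] algebra_simps)
  finally show ?thesis using assms(3) by simp
qed

text \<open>Necessity of the norm condition: some \<open>v\<close> in the lifted lattice agrees with
  \<open>u\<close> modulo \<open>m\<close>, its norm vanishes modulo \<open>2 * m\<close> by
  self-duality, and for even \<open>m\<close> this depends only on residues modulo
  \<open>m\<close>.\<close>

lemma norm_dvd_of_lift:
  assumes "m > 1" "even m" "self_dual_mod m n L"
    and D: "self_dual_code (residue_ring (2 * m)) n D" "reduce_mod m n D = reduce_mod m n L"
    and "u \<in> L"
  shows "2 * m dvd dot n u u"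
proof -
  obtain K where K: "self_dual_mod (2 * m) n K" "D = reduce_mod (2 * m) n K"
    using self_dual_code_residue_ringD[OF _ D(1)] assms(1) by auto
  have "reduce_mod m n K = reduce_mod m n L" using D(2) by (simp add: K(2) reduce_mod_reduce_mod)
  then obtain v where "v \<in> K" "reduce_vec m n u = reduce_vec m n v"
    using \<open>u \<in> L\<close> unfolding reduce_mod_eq_image by blast
  then show ?thesis
    using dvd_norm_of_dvd_diff[OF assms(2), of n u v] self_dual_mod_dvd[OF K(1)] by (simp add: reduce_vec_eq_iff)
qed

lemma liftableI:
  assumes "m > 1" "even m" "self_dual_mod m n L"
    and B: "self_dual_code (residue_ring 2) n (reduce_mod 2 n L)"
    and "\<And>u. u \<in> L \<Longrightarrow> 2 * m dvd dot n u u"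
  shows "liftable m n L"
proof
  fix z assume z: "\<And>v. v \<in> L \<Longrightarrow> even (dot n z v)"
  have "reduce_vec 2 n z \<in> dual_code (residue_ring 2) n (reduce_mod 2 n L)"
    using z reduce_vec_carrier[of 2 n z]
    by (auto simp: dual_code_residue_ring reduce_mod_eq_image dvd_dot_reduce_vec)
  then have "reduce_vec 2 n z \<in> reduce_vec 2 n ` L"
    using B by (simp add: self_dual_code_def reduce_mod_eq_image)
  then show "\<exists>l\<in>L. \<forall>i<n. even (z i - l i)" by (auto simp: reduce_vec_eq_iff)
qed (use assms in auto)

lemma (in liftable) lift_code:
  assumes "m > 1"
  shows "\<exists>D. self_dual_code (residue_ring (2 * m)) n D \<and> reduce_mod m n D = reduce_mod m n L \<and>
    (\<forall>v\<in>D. 4 * m dvd euclidean_norm (2 * m) n v)"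
proof -
  obtain K where K: "self_dual_mod (2 * m) n K" "K \<subseteq> L" "\<And>u. u \<in> K \<Longrightarrow> 4 * m dvd dot n u u"
    "\<And>u. u \<in> L \<Longrightarrow> \<exists>v\<in>K. \<forall>i<n. m dvd u i - v i"
    using lift by blast
  have "self_dual_code (residue_ring (2 * m)) n (reduce_mod (2 * m) n K)"
    using K(1) assms by (intro self_dual_code_reduce_mod) auto
  moreover have "reduce_mod m n (reduce_mod (2 * m) n K) = reduce_mod m n L"
    using reduce_mod_subsetI[OF K(4)] K(2) by (auto simp: reduce_mod_reduce_mod) (auto simp: reduce_mod_eq_image)
  \<comment> \<open>The comparison of norms is applied at the modulus \<open>2 * m\<close>, where it
    holds modulo \<open>4 * m\<close>.\<close>
  moreover have "4 * m dvd euclidean_norm (2 * m) n v" if "v \<in> reduce_mod (2 * m) n K" for v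
    using that K(3) dvd_euclidean_norm_reduce_vec[of "2 * m" n] by (auto simp: reduce_mod_eq_image)
  ultimately show ?thesis by blast
qed

lemma (in liftable) lift_code_chain:
  assumes "m > 1"
  shows "\<exists>D. D 0 = reduce_mod m n L \<and>
    (\<forall>k\<ge>1. self_dual_code (residue_ring (2 ^ k * m)) n (D k) \<and>
      reduce_mod (2 ^ (k - 1) * m) n (D k) = D (k - 1) \<and> reduce_mod m n (D k) = reduce_mod m n L)"
proof -
  obtain K where K0: "K 0 = L" and K: "\<And>k. liftable (2 ^ k * m) n (K k)" "\<And>k. K (Suc k) \<subseteq> K k"
    "\<And>k u. u \<in> K k \<Longrightarrow> \<exists>v\<in>K (Suc k). \<forall>i<n. 2 ^ k * m dvd u i - v i"
    using lift_chain by blast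
  define D where "D = (\<lambda>k. reduce_mod (2 ^ k * m) n (K k))"
  have step: "reduce_mod (2 ^ k * m) n (K (Suc k)) = reduce_mod (2 ^ k * m) n (K k)" for k
    using reduce_mod_subsetI[of "K k" "K (Suc k)", OF K(3)] K(2)[of k] by (auto simp: reduce_mod_eq_image)
  have sd: "self_dual_code (residue_ring (2 ^ k * m)) n (D k)" for k
  proof -
    have "1 * 1 < 2 ^ k * m" by (rule mult_le_less_imp_less) (use assms in auto)
    then show ?thesis unfolding D_def using K(1)[of k] by (intro self_dual_code_reduce_mod) (auto simp: liftable_def)
  qed
  have "reduce_mod m n (K k) = reduce_mod m n L" for k
  proof (induction k)
    case 0
    then show ?case by (simp add: K0)
  next
    case (Suc k)
    have "reduce_mod m n (K (Suc k)) = reduce_mod m n (reduce_mod (2 ^ k * m) n (K (Suc k)))"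
      by (simp add: reduce_mod_reduce_mod)
    also have "\<dots> = reduce_mod m n (K k)" by (simp add: step reduce_mod_reduce_mod)
    finally show ?case using Suc by simp
  qed
  then have "reduce_mod m n (D k) = reduce_mod m n L" for k by (simp add: D_def reduce_mod_reduce_mod)
  moreover have step_D: "reduce_mod (2 ^ k * m) n (D (Suc k)) = D k" for k
    unfolding D_def by (simp add: reduce_mod_reduce_mod step)
  moreover have "D 0 = reduce_mod m n L" by (simp add: D_def K0)
  moreover have "reduce_mod (2 ^ (k - 1) * m) n (D k) = D (k - 1)" if "k \<ge> 1" for k
    using step_D[of "k - 1"] that by simp
  ultimately show ?thesis using sd by (intro exI[of _ D]) simp
qed

text \<open>The second conclusion retains the lattice behind \<open>C\<close>, from which the lift
  with divisible norms and the chain of lifts are obtained.\<close>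

lemma code_lift_iff:
  assumes m: "m \<ge> 2" "even m" and C: "self_dual_code (residue_ring m) n C"
    and B: "self_dual_code (residue_ring 2) n (reduce_mod 2 n C)"
  shows "(\<exists>D. self_dual_code (residue_ring (2 * m)) n D \<and> reduce_mod m n D = C) \<longleftrightarrow>
      (\<forall>u\<in>C. 2 * m dvd euclidean_norm m n u)" (is ?iff)
    and "(\<forall>u\<in>C. 2 * m dvd euclidean_norm m n u) \<Longrightarrow>
      \<exists>L. liftable m n L \<and> C = reduce_mod m n L"
proof -
  have m1: "m > 1" using m by simp
  obtain L where L: "self_dual_mod m n L" "C = reduce_mod m n L"
    using self_dual_code_residue_ringD[OF m1 C] by blast
  have norm: "(\<forall>u\<in>C. 2 * m dvd euclidean_norm m n u) \<longleftrightarrow> (\<forall>u\<in>L. 2 * m dvd dot n u u)"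
    unfolding L(2) reduce_mod_eq_image by (simp add: dvd_euclidean_norm_reduce_vec[OF m(2)])
  have "reduce_mod 2 n C = reduce_mod 2 n L" unfolding L(2) using m(2) by (rule reduce_mod_reduce_mod)
  then have lift: "liftable m n L" if "\<forall>u\<in>C. 2 * m dvd euclidean_norm m n u"
    using that B norm by (intro liftableI[OF m1 m(2) L(1)]) auto
  then show "(\<forall>u\<in>C. 2 * m dvd euclidean_norm m n u) \<Longrightarrow> \<exists>L. liftable m n L \<and> C = reduce_mod m n L"
    using L(2) by blast
  show ?iff
    using norm_dvd_of_lift[OF m1 m(2) L(1)] norm lift liftable.lift_code[OF _ m1] L(2) by metis
qed

section \<open>Hamming weights of binary codes as Euclidean norms\<close>

lemma hamming_weight_eq_euclidean_norm:
  assumes "u \<in> {..<n} \<rightarrow>\<^sub>E {0..1}"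
  shows "int (hamming_weight n u) = euclidean_norm 2 n u"
proof -
  have "(lee 2 (u i))\<^sup>2 = of_bool (u i \<noteq> 0)" if "i < n" for i
  proof -
    have "u i \<in> {0..1}" using assms that by (auto simp: PiE_iff)
    then have "u i = 0 \<or> u i = 1" by auto
    then show ?thesis by (auto simp: lee_def)
  qed
  then show ?thesis by (simp add: hamming_weight_def euclidean_norm_def Int_def)
qed

lemma binary_self_dual_code:
  assumes C: "self_dual_code (residue_ring 2) n C"
  shows "reduce_mod 2 n C = C" "(\<forall>u\<in>C. 4 dvd hamming_weight n u) \<longleftrightarrow> (\<forall>u\<in>C. 4 dvd euclidean_norm 2 n u)"
proof -
  have sub: "C \<subseteq> {..<n} \<rightarrow>\<^sub>E {0..1}"
    using C by (auto simp: self_dual_code_def dual_code_residue_ring)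
  then show "reduce_mod 2 n C = C"
    unfolding reduce_mod_eq_image using reduce_vec_id[of _ n 2] by (simp add: subset_iff)
  have "4 dvd hamming_weight n u \<longleftrightarrow> 4 dvd euclidean_norm 2 n u" if "u \<in> C" for u
  proof -
    have "int (hamming_weight n u) = euclidean_norm 2 n u"
      using sub that by (intro hamming_weight_eq_euclidean_norm) blast
    then show ?thesis by presburger
  qed
  then show "(\<forall>u\<in>C. 4 dvd hamming_weight n u) \<longleftrightarrow> (\<forall>u\<in>C. 4 dvd euclidean_norm 2 n u)" by simp
qed

section \<open>Codes over the 2-adic integers\<close>

lemma carrier_free_module_two_adic_ints:
  "carrier (free_module two_adic_ints n) = {..<n} \<rightarrow>\<^sub>E carrier two_adic_ints"
  by (simp add: free_module_def)

text \<open>Self-duality of the limit code is checked level by level; this requires every member of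
  each lattice of the chain to be the residue of a 2-adic codeword.\<close>

lemma two_adic_lift:
  assumes "liftable 2 n L"
  shows "\<exists>D. self_dual_code two_adic_ints n D \<and> two_adic_reduce_mod2 n D = reduce_mod 2 n L"
proof -
  interpret liftable 2 n L by fact
  \<comment> \<open>The chain starts at modulus 2, so \<open>K k\<close> has modulus
    \<open>2 ^ Suc k\<close> and is matched with component \<open>Suc k\<close> of a 2-adic
    integer.\<close>
  obtain K where K0: "K 0 = L" and K: "\<And>k. liftable (2 ^ Suc k) n (K k)" "\<And>k. K (Suc k) \<subseteq> K k"
    "\<And>k u. u \<in> K k \<Longrightarrow> \<exists>v\<in>K (Suc k). \<forall>i<n. 2 ^ Suc k dvd u i - v i"
    using lift_chain unfolding power_Suc2[symmetric] by blast
  have sdK: "self_dual_mod (2 ^ Suc k) n (K k)" for k using K(1)[of k] by (simp add: liftable_def)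
  have anti: "K (j + k) \<subseteq> K j" for j k by (induction k) (use K(2) in auto)
  define D where "D = {x \<in> carrier (free_module two_adic_ints n). \<forall>k. (\<lambda>i. x i (Suc k)) \<in> K k}"
  \<comment> \<open>Successive lifts of \<open>v\<close> along the chain differ by growing powers of
    2 and so converge 2-adically.\<close>
  have lift_vec: "\<exists>y\<in>D. \<forall>i<n. y i (Suc k) = v i mod 2 ^ Suc k" if v: "v \<in> K k" for k v
  proof -
    have "\<exists>w. \<forall>j. (w j \<in> K (k + j) \<and> (j = 0 \<longrightarrow> w j = v)) \<and> (\<forall>i<n. 2 ^ Suc (k + j) dvd w j i - w (Suc j) i)"
    proof (rule dependent_nat_choice)
      show "\<exists>w. w \<in> K (k + 0) \<and> (0 = (0 :: nat) \<longrightarrow> w = v)" using v by simp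
      fix w j assume "w \<in> K (k + j) \<and> (j = 0 \<longrightarrow> w = v)"
      then show "\<exists>w'. (w' \<in> K (k + Suc j) \<and> (Suc j = 0 \<longrightarrow> w' = v)) \<and> (\<forall>i<n. 2 ^ Suc (k + j) dvd w i - w' i)"
        using K(3)[of w "k + j"] by auto
    qed
    then obtain w where w: "\<And>j. w j \<in> K (k + j)" "w 0 = v"
      "\<And>i j. i < n \<Longrightarrow> 2 ^ Suc (k + j) dvd w j i - w (Suc j) i" by blast
    have step: "w (Suc j) i mod 2 ^ l = w j i mod 2 ^ l" if "i < n" "l \<le> Suc (k + j)" for i j l
      using w(3)[OF that(1), of j] le_imp_power_dvd[OF that(2), of 2] by (metis dvd_trans mod_eq_dvd_iff)
    have const: "w j i mod 2 ^ Suc k = v i mod 2 ^ Suc k" if "i < n" for i j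
      using step[OF that, of "Suc k"] by (induction j) (auto simp: w(2) simp del: power_Suc)
    \<comment> \<open>Later lifts agree with \<open>w j\<close> modulo
      \<open>2 ^ Suc (k + j)\<close>, so \<open>w j\<close> already has the residue of the limit
      modulo \<open>2 ^ j\<close>.\<close>
    define y where "y = (\<lambda>i\<in>{..<n}. \<lambda>j. w j i mod 2 ^ j)"
    have "(\<lambda>j. w j i mod 2 ^ j) \<in> carrier two_adic_ints" if "i < n" for i
      using step[OF that] by (intro two_adic_memI) simp
    then have "y \<in> carrier (free_module two_adic_ints n)"
      by (auto simp: carrier_free_module_two_adic_ints y_def)
    moreover have "(\<lambda>i. y i (Suc j)) \<in> K j" for j
    proof (rule self_dual_mod_cong[OF sdK])
      show "w (Suc j) \<in> K j" using w(1)[of "Suc j"] anti[of j "Suc k"] by (auto simp: add.commute)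
      show "2 ^ Suc j dvd y i (Suc j) - w (Suc j) i" if "i < n" for i
        using that by (simp add: y_def del: power_Suc flip: mod_eq_dvd_iff)
    qed
    moreover have "y i (Suc k) = v i mod 2 ^ Suc k" if "i < n" for i
      using const[OF that] that by (simp add: y_def del: power_Suc)
    ultimately show ?thesis unfolding D_def by (intro bexI[of _ y]) auto
  qed
  have ip: "inner_prod two_adic_ints n x y k = dot n (\<lambda>i. x i k) (\<lambda>i. y i k) mod 2 ^ k"
    if "x \<in> carrier (free_module two_adic_ints n)" "y \<in> carrier (free_module two_adic_ints n)" for x y k
    using that by (intro inner_prod_two_adic_ints) (auto simp: carrier_free_module_two_adic_ints)
  have zero: "\<zero>\<^bsub>two_adic_ints\<^esub> = (\<lambda>k. 0)" by (simp add: two_adic_ints_def)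
  have "D = dual_code two_adic_ints n D"
  proof (intro subset_antisym subsetI)
    fix x assume x: "x \<in> D"
    have "inner_prod two_adic_ints n x y k = 0" if "y \<in> D" for y k
    proof (cases k)
      \<comment> \<open>Level 0 is modulo 1, where every product vanishes; the lattices begin at
        level 1.\<close>
      case 0
      then show ?thesis using x that by (simp add: D_def ip)
    next
      case (Suc l)
      then show ?thesis using self_dual_mod_dvd[OF sdK[of l]] x that
        by (simp add: D_def ip del: power_Suc)
    qed
    then show "x \<in> dual_code two_adic_ints n D" using x by (auto simp: dual_code_def zero D_def)
  next
    fix x assume x: "x \<in> dual_code two_adic_ints n D"
    then have car: "x \<in> carrier (free_module two_adic_ints n)" by (simp add: dual_code_def)
    have "(\<lambda>i. x i (Suc k)) \<in> K k" for k
    proof (rule self_dual_mod_memI[OF sdK])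
      fix v assume "v \<in> K k"
      \<comment> \<open>A codeword congruent to \<open>v\<close> at level \<open>Suc k\<close> turns
        the vanishing 2-adic product into the divisibility required for \<open>v\<close>.\<close>
      then obtain y where y: "y \<in> D" "\<And>i. i < n \<Longrightarrow> y i (Suc k) = v i mod 2 ^ Suc k" using lift_vec by blast
      have "inner_prod two_adic_ints n x y (Suc k) = 0" using x y(1) by (simp add: dual_code_def zero)
      then have "2 ^ Suc k dvd dot n (\<lambda>i. x i (Suc k)) (\<lambda>i. y i (Suc k))"
        using ip[OF car, of y "Suc k"] y(1) by (simp add: D_def dvd_eq_mod_eq_0 del: power_Suc)
      moreover have "2 ^ Suc k dvd dot n v (\<lambda>i. x i (Suc k)) - dot n (\<lambda>i. y i (Suc k)) (\<lambda>i. x i (Suc k))"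
        by (rule dot_cong_mod) (simp add: y(2) del: power_Suc flip: mod_eq_dvd_iff)
      ultimately show "2 ^ Suc k dvd dot n (\<lambda>i. x i (Suc k)) v"
        by (metis dot_commute dvd_add diff_add_cancel)
    qed
    then show "x \<in> D" using car by (simp add: D_def)
  qed
  then have "self_dual_code two_adic_ints n D" by (rule self_dual_codeI[OF cring_two_adic_ints])
  moreover have "two_adic_reduce_mod2 n D = reduce_mod 2 n L"
  proof (intro subset_antisym subsetI)
    fix c assume "c \<in> two_adic_reduce_mod2 n D"
    then obtain x where x: "x \<in> D" "c = (\<lambda>i\<in>{..<n}. x i 1)" by (auto simp: two_adic_reduce_mod2_def map_code_def)
    have "x i 1 mod 2 = x i 1" if "i < n" for i
    proof -
      have "x i \<in> carrier two_adic_ints" using x(1) that by (auto simp: D_def carrier_free_module_two_adic_ints)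
      from two_adic_compat(4)[OF this, of 1] show ?thesis by simp
    qed
    then have "c = reduce_vec 2 n (\<lambda>i. x i 1)" by (auto simp: reduce_vec_def x(2))
    moreover have "(\<lambda>i. x i 1) \<in> L" using x(1) K0 by (auto simp: D_def dest: spec[of _ 0])
    ultimately show "c \<in> reduce_mod 2 n L" by (simp add: reduce_mod_eq_image)
  next
    fix c assume "c \<in> reduce_mod 2 n L"
    then obtain v where v: "v \<in> L" "c = reduce_vec 2 n v" by (auto simp: reduce_mod_eq_image)
    then obtain y where y: "y \<in> D" "\<And>i. i < n \<Longrightarrow> y i 1 = v i mod 2" using lift_vec[of v 0] K0 by auto
    then have "c = (\<lambda>i\<in>{..<n}. y i 1)" by (auto simp: v(2) reduce_vec_def)
    then show "c \<in> two_adic_reduce_mod2 n D" using y(1) by (auto simp: two_adic_reduce_mod2_def map_code_def)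
  qed
  ultimately show ?thesis by blast
qed

section \<open>The binary case and the collected statements\<close>

lemma binary_lift_iff:
  assumes C: "self_dual_code (residue_ring 2) n C"
  shows "(\<exists>D. self_dual_code (residue_ring 4) n D \<and> reduce_mod 2 n D = C) \<longleftrightarrow>
      (\<forall>u\<in>C. 4 dvd hamming_weight n u)"
    and "(\<forall>u\<in>C. 4 dvd hamming_weight n u) \<Longrightarrow> \<exists>L. liftable 2 n L \<and> C = reduce_mod 2 n L"
  using code_lift_iff[of 2 n C] C binary_self_dual_code[OF C] by simp_all

theorem theorem3:
  fixes n :: nat
  shows
    \<comment> \<open>(a)\<close>
    "(\<forall>C. self_dual_code (residue_ring 2) n C \<longrightarrow>
        ((\<exists>D. self_dual_code (residue_ring 4) n D \<and> reduce_mod 2 n D = C) \<longleftrightarrow>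
         (\<forall>u\<in>C. 4 dvd hamming_weight n u)))
     \<and>
     (\<forall>C. self_dual_code (residue_ring 2) n C \<and> (\<forall>u\<in>C. 4 dvd hamming_weight n u) \<longrightarrow>
        (\<exists>D. self_dual_code (residue_ring 4) n D \<and> reduce_mod 2 n D = C \<and>
             (\<forall>v\<in>D. 8 dvd euclidean_norm 4 n v)))
     \<and>
     (\<forall>(m::int) C. m \<ge> 2 \<and> even m \<and> self_dual_code (residue_ring m) n C \<and>
         self_dual_code (residue_ring 2) n (reduce_mod 2 n C) \<longrightarrow>
        ((\<exists>D. self_dual_code (residue_ring (2 * m)) n D \<and> reduce_mod m n D = C) \<longleftrightarrow>
         (\<forall>u\<in>C. 2 * m dvd euclidean_norm m n u))
        \<and>
        ((\<forall>u\<in>C. 2 * m dvd euclidean_norm m n u) \<longrightarrow>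
         (\<exists>D. self_dual_code (residue_ring (2 * m)) n D \<and> reduce_mod m n D = C \<and>
              (\<forall>v\<in>D. 4 * m dvd euclidean_norm (2 * m) n v)))
        \<and>
        ((\<exists>D. self_dual_code (residue_ring (2 * m)) n D \<and> reduce_mod m n D = C) \<longrightarrow>
         (\<exists>D :: nat \<Rightarrow> (nat \<Rightarrow> int) set. D 0 = C \<and>
            (\<forall>k\<ge>1. self_dual_code (residue_ring (2 ^ k * m)) n (D k) \<and>
                    reduce_mod (2 ^ (k - 1) * m) n (D k) = D (k - 1) \<and>
                    reduce_mod m n (D k) = C))))
     \<and>
     (\<forall>C. self_dual_code (residue_ring 2) n C \<and>
         (\<exists>D. self_dual_code (residue_ring 4) n D \<and> reduce_mod 2 n D = C) \<longrightarrow>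
        (\<exists>D. self_dual_code two_adic_ints n D \<and> two_adic_reduce_mod2 n D = C))"
proof (intro conjI allI impI)
  fix C assume C: "self_dual_code (residue_ring 2) n C"
  show "(\<exists>D. self_dual_code (residue_ring 4) n D \<and> reduce_mod 2 n D = C) \<longleftrightarrow>
      (\<forall>u\<in>C. 4 dvd hamming_weight n u)"
    by (rule binary_lift_iff(1)[OF C])
next
  fix C assume "self_dual_code (residue_ring 2) n C \<and> (\<forall>u\<in>C. 4 dvd hamming_weight n u)"
  then obtain L where "liftable 2 n L" "C = reduce_mod 2 n L" using binary_lift_iff(2) by blast
  then show "\<exists>D. self_dual_code (residue_ring 4) n D \<and> reduce_mod 2 n D = C \<and>
      (\<forall>v\<in>D. 8 dvd euclidean_norm 4 n v)"
    using liftable.lift_code[of 2 n L] by simp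
next
  fix m C
  assume "m \<ge> 2 \<and> even m \<and> self_dual_code (residue_ring m) n C \<and>
    self_dual_code (residue_ring 2) n (reduce_mod 2 n C)"
  then have m: "m \<ge> 2" "even m" and C: "self_dual_code (residue_ring m) n C"
    "self_dual_code (residue_ring 2) n (reduce_mod 2 n C)" by simp_all
  note iff = code_lift_iff(1)[OF m C] and liftable = code_lift_iff(2)[OF m C]
  have m1: "m > 1" using m by simp
  show "(\<exists>D. self_dual_code (residue_ring (2 * m)) n D \<and> reduce_mod m n D = C) \<longleftrightarrow>
      (\<forall>u\<in>C. 2 * m dvd euclidean_norm m n u)" by (rule iff)
  show "\<exists>D. self_dual_code (residue_ring (2 * m)) n D \<and> reduce_mod m n D = C \<and>
      (\<forall>v\<in>D. 4 * m dvd euclidean_norm (2 * m) n v)"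
    if "\<forall>u\<in>C. 2 * m dvd euclidean_norm m n u"
    using liftable[OF that] liftable.lift_code[OF _ m1] by metis
  show "\<exists>D :: nat \<Rightarrow> (nat \<Rightarrow> int) set. D 0 = C \<and>
      (\<forall>k\<ge>1. self_dual_code (residue_ring (2 ^ k * m)) n (D k) \<and>
        reduce_mod (2 ^ (k - 1) * m) n (D k) = D (k - 1) \<and> reduce_mod m n (D k) = C)"
    if ex: "\<exists>D. self_dual_code (residue_ring (2 * m)) n D \<and> reduce_mod m n D = C"
  proof -
    obtain L where "liftable m n L" "C = reduce_mod m n L" using liftable ex iff by blast
    then show ?thesis using liftable.lift_code_chain[OF _ m1] by blast
  qed
next
  fix C
  assume "self_dual_code (residue_ring 2) n C \<and>
    (\<exists>D. self_dual_code (residue_ring 4) n D \<and> reduce_mod 2 n D = C)"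
  then obtain L where "liftable 2 n L" "C = reduce_mod 2 n L" using binary_lift_iff by metis
  then show "\<exists>D. self_dual_code two_adic_ints n D \<and> two_adic_reduce_mod2 n D = C"
    using two_adic_lift by blast
qed

end
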